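(* For $n\geq1$ let $\mathbb B_n:=\mathbb Q(X_n)$ with $X_n:=2\cos(2\pi/2^{n+2})$, let $\sigma$ be the generator of $\mathrm{Gal}(\mathbb B_n/\mathbb Q)$ with $\sigma(X_n)=2\cos(3\cdot 2\pi/2^{n+2})$, let $\varepsilon_n:=\frac{X_n+1}{X_n-1}$, let $b_0:=1$ and $b_i:=2\cos(i\cdot 2\pi/2^{n+2})$ for $1\leq i\leq 2^n-1$, and let $RE_n^+:=\{\epsilon\in\mathcal O_{\mathbb B_n}^\times\mid \mathrm{N}_{\mathbb B_n/\mathbb B_{n-1}}(\epsilon)=1\}$. Define $c_1:=2$ and $c_n:=2\cdot\mathrm{round}(2^n/5)$ for $n\geq2$, where $\mathrm{round}(x)$ is the nearest integer to $x$. Define $$u_1:=\varepsilon_1=3b_0+2b_1,\qquad u_3:=\varepsilon_3\,\sigma(\varepsilon_3)=b_0+2(b_1+b_2+b_5+b_6),$$ $$u_5:=\varepsilon_5\,\sigma^2(\varepsilon_5)=b_0+2(b_{11}+b_{12}-b_{14}-b_{15}+b_{17}+b_{18}+b_{19}+b_{20}-b_{22}-b_{23}+b_{25}+b_{26}),$$ and, for even $n\geq2$, $$u_n:=b_0+(-1)^{n/2}\,2\sum_{i=\lceil 2^{n+1}/5\rceil}^{\lfloor 2^{n+2}/5\rfloor} b_i .$$ Then for $n\in\{1,3,5\}$ and for every even $n\geq 2$, $u_n\in RE_n^+\setminus\{\pm1\}$ and $$\mathrm{Tr}_{\mathbb B_n/\mathbb Q}(u_n^2)=2^n(1+8c_n).$$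 In particular, for such $n$, $\min\{\mathrm{Tr}\,\epsilon^2\mid \pm1\neq\epsilon\in RE_n^+\}\leq 2^n(1+8c_n)$.
   Context: $\mathbb B_n$ is the $n$th layer of the cyclotomic $\mathbb Z_2$-extension of $\mathbb Q$, of degree $2^n$, containing $\mathbb B_{n-1}$ with index $2$; $\mathrm{N}_{\mathbb B_n/\mathbb B_{n-1}}$ is the relative norm and $\mathrm{Tr}$ the absolute trace. $\lceil\cdot\rceil$ and $\lfloor\cdot\rfloor$ are the ceiling and floor functions. *)

theory Defs
  imports
    Complex_Main
    "HOL-Computational_Algebra.Computational_Algebra"
    "HOL-Algebra.Bij"
    "HOL-Algebra.Generated_Groups"
begin

text \<open>All fields considered here are subfields of the real numbers.\<close>

definition real_subfield :: "real set \<Rightarrow> bool" where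
  "real_subfield K \<longleftrightarrow> 1 \<in> K \<and>
     (\<forall>x\<in>K. \<forall>y\<in>K. x - y \<in> K \<and> x * y \<in> K) \<and> (\<forall>x\<in>K. inverse x \<in> K)"

definition X :: "nat \<Rightarrow> real" where
  "X n = 2 * cos (2 * pi / 2 ^ (n + 2))"

text \<open>The smallest subfield of the reals containing \<open>X n\<close>, i.e. \<open>\<rat>(X n)\<close>.
  Since \<open>X 0 = 0\<close>, the bottom layer \<open>BB 0\<close> is the field of rationals.\<close>

definition BB :: "nat \<Rightarrow> real set" where
  "BB n = real_subfield hull {X n}"

text \<open>\<open>Gal K F\<close> is the group of field automorphisms of \<open>K\<close> fixing \<open>F\<close> pointwise, as a
  subset of \<open>Bij K\<close>; its elements are extensional (\<open>undefined\<close> outside \<open>K\<close>), so that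
  distinct members differ on \<open>K\<close>. The group law is that of \<open>BijGroup K\<close>.\<close>

definition Gal :: "real set \<Rightarrow> real set \<Rightarrow> (real \<Rightarrow> real) set" where
  "Gal K F = {\<tau> \<in> Bij K.
     (\<forall>x\<in>K. \<forall>y\<in>K. \<tau> (x + y) = \<tau> x + \<tau> y \<and> \<tau> (x * y) = \<tau> x * \<tau> y) \<and>
     (\<forall>x\<in>F. \<tau> x = x)}"

text \<open>Norm and trace of a finite Galois extension \<open>K/F\<close>, as product and sum of the conjugates.
  They are only used for \<open>BB n\<close> over \<open>BB (n - 1)\<close> and over \<open>\<rat>\<close>, which are Galois.\<close>

definition rel_norm :: "real set \<Rightarrow> real set \<Rightarrow> real \<Rightarrow> real" where
  "rel_norm K F x = (\<Prod>\<tau>\<in>Gal K F. \<tau> x)"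

definition rel_trace :: "real set \<Rightarrow> real set \<Rightarrow> real \<Rightarrow> real" where
  "rel_trace K F x = (\<Sum>\<tau>\<in>Gal K F. \<tau> x)"

abbreviation Tr :: "nat \<Rightarrow> real \<Rightarrow> real" where
  "Tr n \<equiv> rel_trace (BB n) \<rat>"

definition ring_of_integers :: "real set \<Rightarrow> real set" where
  "ring_of_integers K = {x \<in> K. algebraic_int x}"

definition integer_units :: "real set \<Rightarrow> real set" where
  "integer_units K = {x \<in> ring_of_integers K. \<exists>y \<in> ring_of_integers K. x * y = 1}"

definition RE_plus :: "nat \<Rightarrow> real set" where
  "RE_plus n = {e \<in> integer_units (BB n). rel_norm (BB n) (BB (n - 1)) e = 1}"

definition sigma :: "nat \<Rightarrow> real \<Rightarrow> real" where
  "sigma n = (THE \<tau>. \<tau> \<in> Gal (BB n) \<rat> \<and>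
     generate (BijGroup (BB n)) {\<tau>} = Gal (BB n) \<rat> \<and>
     \<tau> (X n) = 2 * cos (3 * (2 * pi / 2 ^ (n + 2))))"

definition eps :: "nat \<Rightarrow> real" where
  "eps n = (X n + 1) / (X n - 1)"

definition b :: "nat \<Rightarrow> nat \<Rightarrow> real" where
  "b n i = (if i = 0 then 1 else 2 * cos (real i * (2 * pi / 2 ^ (n + 2))))"

text \<open>No ties occur in the rounding, as \<open>2 ^ n / 5\<close> is never a half-integer.\<close>

definition c :: "nat \<Rightarrow> int" where
  "c n = (if n = 1 then 2 else 2 * round (2 ^ n / 5 :: real))"

text \<open>Only meaningful for \<open>n \<in> {1, 3, 5}\<close> and for even \<open>n \<ge> 2\<close>.\<close>

definition u :: "nat \<Rightarrow> real" where
  "u n =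
    (if n = 1 then eps 1
     else if n = 3 then eps 3 * sigma 3 (eps 3)
     else if n = 5 then eps 5 * (sigma 5 ^^ 2) (eps 5)
     else b n 0 + (-1) ^ (n div 2) * 2 *
       (\<Sum>i = nat \<lceil>2 ^ (n + 1) / 5 :: real\<rceil>..nat \<lfloor>2 ^ (n + 2) / 5 :: real\<rfloor>. b n i))"

end

theory Submission
  imports Defs "Jordan_Normal_Form.Char_Poly"
begin

text \<open>
  Let \<open>\<theta> = 2 * pi / 2 ^ (n + 2)\<close>. The conjugates of \<open>X n = 2 cos \<theta>\<close> are the numbers
  \<open>2 cos (j * \<theta>)\<close> with \<open>j\<close> odd, because \<open>X n\<close> is a root of an Eisenstein polynomial
  at \<open>2\<close>; so the trace is a sum over odd \<open>j\<close>, and for the trace form the \<open>b n i\<close> with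
  \<open>0 < i < 2 ^ n\<close> are orthogonal of norm \<open>2 * 2 ^ n\<close>. This gives the trace of \<open>u\<^sup>2\<close> by counting
  the terms of \<open>u\<close>. The relative norm multiplies \<open>x\<close> by its conjugate under
  \<open>X n \<mapsto> - X n\<close>. For odd \<open>n\<close> this inverts \<open>eps n\<close>. For even \<open>n\<close>, choose \<open>k\<close> odd with
  \<open>5 * k \<equiv> \<plusminus> 1\<close> modulo \<open>2 ^ (n + 2)\<close>; summing the cosines shows \<open>u n = tan t / tan (5 * t)\<close>
  with \<open>t = k * \<theta> / 2\<close>, and the conjugation shifts \<open>t\<close> by an odd multiple of \<open>pi / 2\<close>, which inverts
  this quotient. The minimum exists because the trace of the square of an algebraic integer
  of \<open>BB n\<close> is a natural number.
\<close>

section \<open>Algebraic integers form a ring\<close>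

text \<open>Independence of the powers of \<open>X n\<close> is obtained without ideals: all
  divisibility takes place among the real algebraic integers, where \<open>X n ^ 2 ^ n\<close> and
  \<open>2\<close> divide each other. This is the total ramification of 2, and it is why these reals
  must first be known to form a ring.

  The units have a common origin. From \<open>sin (3 * t) = sin t * (2 * cos (2 * t) + 1)\<close>
  and \<open>cos (3 * t) = cos t * (2 * cos (2 * t) - 1)\<close>, \<open>eps n\<close> is
  \<open>tan (3 * t) / tan t\<close> at half the basic angle; the even units are quotients of the
  same kind with 5 in place of 3. The fifths in their summation range come from this 5: the ends of
  the cosine sum become \<open>t\<close> and \<open>3 * t\<close>, up to reflection, when
  \<open>5 * \<gamma>\<close> is \<open>2 ^ n + 1\<close> or \<open>2 ^ n - 1\<close>. Such a
  \<open>\<gamma>\<close> exists exactly for even \<open>n\<close>, since \<open>2 ^ n\<close> is 2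
  or -2 modulo 5 for odd \<open>n\<close>; hence 1, 3 and 5 are computed separately.

  As \<open>sigma n\<close> is a definite description, it must first be identified. This rests on 3
  and -1 generating the odd residues modulo \<open>2 ^ (n + 2)\<close>.\<close>

lemma algebraic_int_lattice_eigenvalue:
  fixes x :: real and v :: "'i \<Rightarrow> real" and A :: "'i \<Rightarrow> 'i \<Rightarrow> int"
  assumes fin: "finite I" and nz: "k \<in> I" "v k \<noteq> 0"
    and eq: "\<And>i. i \<in> I \<Longrightarrow> x * v i = (\<Sum>j\<in>I. of_int (A i j) * v j)"
  shows "algebraic_int x"
proof -
  define d where "d = card I"
  obtain h where h: "bij_betw h {0..<d} I"
    using ex_bij_betw_nat_finite[OF fin] d_def by blast
  define B where "B = mat d d (\<lambda>(i, j). A (h i) (h j))"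
  define C where "C = map_mat real_of_int B"
  define w where "w = vec d (\<lambda>i. v (h i))"
  have B: "B \<in> carrier_mat d d" by (simp add: B_def)
  have C: "C \<in> carrier_mat d d" by (simp add: C_def B)
  have "C *\<^sub>v w = x \<cdot>\<^sub>v w"
  proof (rule eq_vecI)
    fix i assume "i < dim_vec (x \<cdot>\<^sub>v w)"
    then have i: "i < d" by (simp add: w_def)
    have hi: "h i \<in> I" using h i by (auto simp: bij_betw_def)
    have "vec_index (C *\<^sub>v w) i = (\<Sum>j\<in>{0..<d}. of_int (A (h i) (h j)) * v (h j))"
      using i by (simp add: C_def B_def w_def scalar_prod_def)
    also have "\<dots> = (\<Sum>j\<in>I. of_int (A (h i) j) * v j)"
      by (rule sum.reindex_bij_betw[OF h])
    also have "\<dots> = vec_index (x \<cdot>\<^sub>v w) i" using i eq[OF hi] by (simp add: w_def)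
    finally show "vec_index (C *\<^sub>v w) i = vec_index (x \<cdot>\<^sub>v w) i" .
  qed (use C in \<open>auto simp: w_def\<close>)
  moreover obtain l where l: "l < d" "h l = k"
    using h nz(1) by (auto simp: bij_betw_def)
  have "w \<noteq> 0\<^sub>v d"
  proof
    assume "w = 0\<^sub>v d"
    then have "vec_index w l = 0" using l by simp
    then show False using l nz by (simp add: w_def)
  qed
  ultimately have "eigenvalue C x"
    unfolding eigenvalue_def eigenvector_def using C by (intro exI[of _ w]) (auto simp: w_def)
  then have "poly (char_poly C) x = 0"
    using eigenvalue_root_char_poly[OF C] by simp
  moreover have "char_poly C = map_poly of_int (char_poly B)"
    unfolding C_def by (rule of_int_hom.char_poly_hom[OF B])
  moreover have "lead_coeff (char_poly B) = 1"
    using degree_monic_char_poly[OF B] by simp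
  ultimately show ?thesis by (auto simp: algebraic_int_altdef_ipoly)
qed

definition int_lattice :: "'i set \<Rightarrow> ('i \<Rightarrow> real) \<Rightarrow> real set" where
  "int_lattice I v = range (\<lambda>a. \<Sum>i\<in>I. of_int (a i) * v i)"

lemma int_latticeI: "z = (\<Sum>i\<in>I. of_int (a i) * v i) \<Longrightarrow> z \<in> int_lattice I v"
  by (auto simp: int_lattice_def)

lemma int_lattice_zero: "0 \<in> int_lattice I v"
  by (rule int_latticeI[where a = "\<lambda>_. 0"]) simp

lemma int_lattice_add:
  assumes "x \<in> int_lattice I v" "y \<in> int_lattice I v"
  shows "x + y \<in> int_lattice I v"
proof -
  obtain p q where "x = (\<Sum>i\<in>I. of_int (p i) * v i)" "y = (\<Sum>i\<in>I. of_int (q i) * v i)"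
    using assms by (auto simp: int_lattice_def)
  then have "x + y = (\<Sum>i\<in>I. of_int (p i + q i) * v i)"
    by (simp add: sum.distrib algebra_simps)
  then show ?thesis by (rule int_latticeI)
qed

lemma int_lattice_int_mult:
  assumes "x \<in> int_lattice I v" shows "of_int k * x \<in> int_lattice I v"
proof -
  obtain p where "x = (\<Sum>i\<in>I. of_int (p i) * v i)"
    using assms by (auto simp: int_lattice_def)
  then have "of_int k * x = (\<Sum>i\<in>I. of_int (k * p i) * v i)"
    by (simp add: sum_distrib_left algebra_simps)
  then show ?thesis by (rule int_latticeI)
qed

lemma int_lattice_sum:
  assumes "\<And>j. j \<in> J \<Longrightarrow> f j \<in> int_lattice I v"
  shows "(\<Sum>j\<in>J. of_int (a j) * f j) \<in> int_lattice I v"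
  using assms
  by (induction J rule: infinite_finite_induct)
    (auto simp: int_lattice_zero intro!: int_lattice_add int_lattice_int_mult)

lemma int_lattice_generator:
  assumes "finite I" "i \<in> I" shows "v i \<in> int_lattice I v"
proof -
  have "(\<Sum>j\<in>I. of_int (if j = i then 1 else 0) * v j) = (\<Sum>j\<in>I. if j = i then v j else 0)"
    by (intro sum.cong) auto
  also have "\<dots> = v i" using assms by simp
  finally show ?thesis by (intro int_latticeI) (rule sym)
qed

text \<open>Multiplication by \<open>x\<close> acts on the generators through an integer matrix, and
  \<open>v\<close> is an eigenvector because one entry is nonzero. The generators may be dependent,
  and no polynomial for \<open>x\<close> has to be exhibited.\<close>

lemma algebraic_int_if_stable_lattice:
  assumes "finite I" "k \<in> I" "v k \<noteq> 0"
    and "\<And>i. i \<in> I \<Longrightarrow> x * v i \<in> int_lattice I v"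
  shows "algebraic_int x"
proof -
  have "\<exists>A. \<forall>i\<in>I. x * v i = (\<Sum>j\<in>I. of_int (A i j) * v j)"
    using assms(4) unfolding int_lattice_def by (intro bchoice) blast
  then obtain A where "\<And>i. i \<in> I \<Longrightarrow> x * v i = (\<Sum>j\<in>I. of_int (A i j) * v j)"
    by blast
  then show ?thesis
    using algebraic_int_lattice_eigenvalue[where v = v, OF assms(1-3)] by blast
qed

lemma int_lattice_stable:
  assumes "\<And>i. i \<in> I \<Longrightarrow> x * v i \<in> int_lattice I v" "z \<in> int_lattice I v"
  shows "x * z \<in> int_lattice I v"
proof -
  obtain p where "z = (\<Sum>i\<in>I. of_int (p i) * v i)"
    using assms by (auto simp: int_lattice_def)
  then have "x * z = (\<Sum>i\<in>I. of_int (p i) * (x * v i))"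
    by (simp add: sum_distrib_left algebra_simps)
  moreover have "(\<Sum>i\<in>I. of_int (p i) * (x * v i)) \<in> int_lattice I v"
    by (rule int_lattice_sum) (rule assms(1))
  ultimately show ?thesis by simp
qed

lemma algebraic_int_power_relation:
  fixes x :: real
  assumes "algebraic_int x"
  obtains d a where "d > 0" "x ^ d = (\<Sum>i<d. of_int (a i) * x ^ i)"
proof -
  obtain p where p: "poly (map_poly of_int p) x = 0" "lead_coeff p = (1::int)"
    using assms by (auto simp: algebraic_int_altdef_ipoly)
  define d where "d = degree p"
  \<comment> \<open>A monic constant polynomial is 1 and has no root.\<close>
  have d: "d > 0"
    using p by (intro Nat.gr0I) (auto simp: d_def elim!: degree_eq_zeroE)
  have "0 = (\<Sum>i\<le>d. of_int (coeff p i) * x ^ i)"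
    using p(1) by (simp add: poly_altdef d_def degree_map_poly coeff_map_poly)
  also have "\<dots> = (\<Sum>i<d. of_int (coeff p i) * x ^ i) + x ^ d"
    using p(2) d by (simp add: d_def lessThan_Suc_atMost[symmetric])
  finally have "x ^ d = - (\<Sum>i<d. of_int (coeff p i) * x ^ i)"
    by linarith
  also have "\<dots> = (\<Sum>i<d. of_int (- coeff p i) * x ^ i)"
    by (simp add: sum_negf)
  finally show ?thesis by (rule that[OF d])
qed

text \<open>The monomials \<open>x ^ i * y ^ j\<close> with \<open>i < d\<close>,
  \<open>j < e\<close> span a lattice stable under both factors: an exponent leaves its range only
  by reaching \<open>d\<close> or \<open>e\<close>, where the monic relation rewrites the power.
  Stability under \<open>x\<close> and \<open>y\<close> passes to sum and product.\<close>

lemma algebraic_int_plus_times: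
  fixes x y :: real
  assumes x: "algebraic_int x" and y: "algebraic_int y"
  shows "algebraic_int (x + y)" "algebraic_int (x * y)"
proof -
  obtain d p where d: "d > 0" and p: "x ^ d = (\<Sum>i<d. of_int (p i) * x ^ i)"
    using algebraic_int_power_relation[OF x] by blast
  obtain e q where e: "e > 0" and q: "y ^ e = (\<Sum>i<e. of_int (q i) * y ^ i)"
    using algebraic_int_power_relation[OF y] by blast
  define I where "I = {..<d} \<times> {..<e}"
  define v where "v = (\<lambda>(i, j). x ^ i * y ^ j)"
  have fin: "finite I" by (simp add: I_def)
  have k: "(0, 0) \<in> I" "v (0, 0) \<noteq> 0" using d e by (auto simp: I_def v_def)
  have gen: "x ^ i * y ^ j \<in> int_lattice I v" if "i < d" "j < e" for i j
    using int_lattice_generator[OF fin, of "(i, j)" v] that by (simp add: I_def v_def)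
  have sx: "x * v l \<in> int_lattice I v" if "l \<in> I" for l
  proof -
    obtain i j where l: "l = (i, j)" "i < d" "j < e" using \<open>l \<in> I\<close> by (auto simp: I_def)
    show ?thesis
    proof (cases "Suc i < d")
      case True
      then show ?thesis using gen[OF True l(3)] by (simp add: l v_def mult_ac)
    next
      case False
      then have "Suc i = d" using l by simp
      then have "x * v l = x ^ d * y ^ j" by (auto simp: l v_def)
      also have "\<dots> = (\<Sum>i<d. of_int (p i) * (x ^ i * y ^ j))"
        by (simp add: p sum_distrib_left sum_distrib_right mult_ac)
      also have "\<dots> \<in> int_lattice I v" by (intro int_lattice_sum gen) (use l in auto)
      finally show ?thesis .
    qed
  qed
  have sy: "y * v l \<in> int_lattice I v" if "l \<in> I" for l
  proof -
    obtain i j where l: "l = (i, j)" "i < d" "j < e" using \<open>l \<in> I\<close> by (auto simp: I_def)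
    show ?thesis
    proof (cases "Suc j < e")
      case True
      then show ?thesis using gen[OF l(2) True] by (simp add: l v_def mult_ac)
    next
      case False
      then have "Suc j = e" using l by simp
      then have "y * v l = x ^ i * y ^ e" by (auto simp: l v_def)
      also have "\<dots> = (\<Sum>j<e. of_int (q j) * (x ^ i * y ^ j))"
        by (simp add: q sum_distrib_left sum_distrib_right mult_ac)
      also have "\<dots> \<in> int_lattice I v" by (intro int_lattice_sum gen) (use l in auto)
      finally show ?thesis .
    qed
  qed
  show "algebraic_int (x + y)"
  proof (rule algebraic_int_if_stable_lattice[where v = v, OF fin k])
    fix l assume "l \<in> I"
    then show "(x + y) * v l \<in> int_lattice I v"
      unfolding distrib_right by (intro int_lattice_add sx sy)
  qed
  show "algebraic_int (x * y)"
  proof (rule algebraic_int_if_stable_lattice[where v = v, OF fin k])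
    fix l assume "l \<in> I"
    then show "(x * y) * v l \<in> int_lattice I v"
      unfolding mult.assoc by (intro int_lattice_stable[of I x v "y * v l"] sx sy)
  qed
qed

lemma algebraic_int_of_int [simp]: "algebraic_int (of_int k :: real)"
  by (rule int_imp_algebraic_int) simp

lemma algebraic_int_1 [simp]: "algebraic_int (1 :: real)"
  using algebraic_int_of_int[of 1] by simp

lemma algebraic_int_numeral [simp]: "algebraic_int (numeral w :: real)"
  using algebraic_int_of_int[of "numeral w"] by simp

lemma algebraic_int_diff:
  fixes x y :: real
  assumes "algebraic_int x" "algebraic_int y" shows "algebraic_int (x - y)"
  using algebraic_int_plus_times(1)[OF assms(1), of "- y"] assms(2) by simp

lemma algebraic_int_power:
  fixes x :: real
  assumes "algebraic_int x" shows "algebraic_int (x ^ k)"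
  by (induction k) (simp_all add: algebraic_int_plus_times(2)[OF assms])

lemma algebraic_int_sum:
  fixes f :: "'i \<Rightarrow> real"
  assumes "\<And>i. i \<in> I \<Longrightarrow> algebraic_int (f i)"
  shows "algebraic_int (\<Sum>i\<in>I. f i)"
  using assms
proof (induction I rule: infinite_finite_induct)
  case (insert i F)
  then show ?case by (simp add: algebraic_int_plus_times(1))
qed simp_all

lemmas algebraic_int_closed =
  algebraic_int_plus_times algebraic_int_diff algebraic_int_power algebraic_int_sum

section \<open>The prime above 2 and linear independence of the powers of X\<close>

lemma X_0 [simp]: "X 0 = 0"
proof -
  have "2 * pi / 2 ^ (0 + 2) = pi / 2" by simp
  then show ?thesis unfolding X_def by (simp only: cos_pi_half mult_zero_right)
qed

lemma X_Suc_squared: "(X (Suc n))\<^sup>2 = X n + 2"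
proof -
  have "cos (2 * pi / 2 ^ (n + 2)) = cos (2 * (2 * pi / 2 ^ (Suc n + 2)))"
    by (simp add: field_simps)
  then show ?thesis
    unfolding X_def cos_double_cos by (simp add: power_mult_distrib)
qed

lemma X_eq: "X n = (X (Suc n))\<^sup>2 - 2"
  using X_Suc_squared[of n] by simp

lemma angle_less_half_pi: "n > 0 \<Longrightarrow> 2 * pi / 2 ^ (n + 2) < pi / 2"
proof -
  assume "n > 0"
  then have "(2::real) ^ 2 < 2 ^ (n + 2)" by (intro power_strict_increasing) auto
  then show ?thesis by (simp add: field_simps)
qed

lemma X_pos: "n > 0 \<Longrightarrow> X n > 0"
  unfolding X_def using angle_less_half_pi[of n] pi_gt_zero
  by (intro mult_pos_pos cos_gt_zero_pi) (auto intro: less_trans[of _ 0])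

lemma algebraic_int_X [simp]: "algebraic_int (X n)"
proof (induction n)
  case (Suc n)
  have "X (Suc n) = sqrt (X n + 2)"
    using X_Suc_squared[of n] X_pos[of "Suc n"] by (metis less_imp_le real_sqrt_unique zero_less_Suc)
  then show ?case using Suc by (auto intro!: algebraic_int_sqrt algebraic_int_plus_times)
qed simp

text \<open>The quotient may be any real algebraic integer, not only one in \<open>BB n\<close>.
  Different layers can thus be compared directly, and no integral basis is needed.\<close>

definition aint_dvd :: "real \<Rightarrow> real \<Rightarrow> bool" where
  "aint_dvd x y \<longleftrightarrow> (\<exists>z. algebraic_int z \<and> y = x * z)"

lemma aint_dvdI: "algebraic_int z \<Longrightarrow> y = x * z \<Longrightarrow> aint_dvd x y"
  unfolding aint_dvd_def by blast

lemma aint_dvd_trans: "aint_dvd x y \<Longrightarrow> aint_dvd y z \<Longrightarrow> aint_dvd x z"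
  unfolding aint_dvd_def by (metis algebraic_int_plus_times(2) mult.assoc)

lemma aint_dvd_add: "aint_dvd x y \<Longrightarrow> aint_dvd x z \<Longrightarrow> aint_dvd x (y + z)"
  unfolding aint_dvd_def by (metis algebraic_int_plus_times(1) distrib_left)

lemma aint_dvd_mult: "aint_dvd x y \<Longrightarrow> algebraic_int z \<Longrightarrow> aint_dvd x (y * z)"
  unfolding aint_dvd_def by (metis algebraic_int_plus_times(2) mult.assoc)

lemma aint_dvd_minus: "aint_dvd x y \<Longrightarrow> aint_dvd x (- y)"
  using aint_dvd_mult[of x y "-1"] by simp

lemma aint_dvd_0 [simp]: "aint_dvd x 0"
  by (rule aint_dvdI[of 0]) simp_all

lemma aint_dvd_sum:
  assumes "\<And>i. i \<in> I \<Longrightarrow> aint_dvd x (f i)"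
  shows "aint_dvd x (sum f I)"
  using assms
proof (induction I rule: infinite_finite_induct)
  case (insert i F)
  have "aint_dvd x (f i + sum f F)"
    by (intro aint_dvd_add insert.IH) (auto intro: insert.prems)
  then show ?case using insert.hyps by simp
qed simp_all

lemma not_aint_dvd_2_1: "\<not> aint_dvd 2 1"
proof
  assume "aint_dvd 2 1"
  then obtain z where z: "algebraic_int z" "2 * z = (1::real)" unfolding aint_dvd_def by metis
  then have z_eq: "z = 1 / 2" by simp
  have "z \<in> \<rat>" unfolding z_eq by (intro Rats_divide) simp_all
  with z(1) have "z \<in> \<int>" by (rule rational_algebraic_int_is_int)
  then obtain k where "z = of_int k" by (auto elim: Ints_cases)
  with z(2) have "real_of_int (2 * k) = real_of_int 1" by simp
  then have "2 * k = 1" unfolding of_int_eq_iff .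
  then show False by presburger
qed

lemma aint_dvd_2_power_diff:
  "algebraic_int x \<Longrightarrow> aint_dvd 2 ((x + 2) ^ k - x ^ k)"
proof (induction k)
  case 0
  then show ?case by simp
next
  case (Suc k)
  have "(x + 2) ^ Suc k - x ^ Suc k = ((x + 2) ^ k - x ^ k) * x + 2 * (x + 2) ^ k"
    by (simp add: algebra_simps)
  moreover have "aint_dvd 2 (((x + 2) ^ k - x ^ k) * x)"
    using Suc by (intro aint_dvd_mult) auto
  moreover have "aint_dvd 2 (2 * (x + 2) ^ k)"
    using Suc.prems
    by (intro aint_dvdI[of "(x + 2) ^ k"] algebraic_int_power algebraic_int_plus_times(1)) auto
  ultimately show ?case by (simp only: aint_dvd_add)
qed

text \<open>Modulo 2 the square of \<open>X (Suc n)\<close> is \<open>X n\<close>, so the power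
  descends layer by layer to \<open>X 0 = 0\<close>.\<close>

lemma aint_dvd_2_X_power: "aint_dvd 2 (X n ^ 2 ^ n)"
proof (induction n)
  case 0
  then show ?case by simp
next
  case (Suc n)
  have "X (Suc n) ^ 2 ^ Suc n = (X n + 2) ^ 2 ^ n"
    by (simp add: power_mult X_Suc_squared)
  also have "\<dots> = ((X n + 2) ^ 2 ^ n - X n ^ 2 ^ n) + X n ^ 2 ^ n" by simp
  finally show ?case
    by (simp only: aint_dvd_add aint_dvd_2_power_diff algebraic_int_X Suc)
qed

text \<open>Two layers up, \<open>2 - X k\<close> splits as
  \<open>Y\<^sup>2 * (4 - Y\<^sup>2)\<close> with \<open>Y = X (k + 2)\<close>; higher layers follow
  from \<open>2 - X k = (2 - X (k + 1)) * (2 + X (k + 1))\<close>. The case \<open>k = 0\<close>,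
  where \<open>X 0 = 0\<close>, is the one wanted.\<close>

lemma X_squared_aint_dvd_2_minus_X: "aint_dvd ((X (k + 2 + j))\<^sup>2) (2 - X k)"
proof (induction j arbitrary: k)
  case 0
  have "2 - X k = (X (k + 2))\<^sup>2 * (4 - (X (k + 2))\<^sup>2)"
    by (simp add: X_eq[of k] X_eq[of "Suc k"] power2_eq_square algebra_simps)
  then show ?case
    by (auto intro!: aint_dvdI[of "4 - (X (k + 2))\<^sup>2"] algebraic_int_diff algebraic_int_power)
next
  case (Suc j)
  have "2 - X k = (2 - X (Suc k)) * (2 + X (Suc k))"
    by (simp add: X_eq[of k] power2_eq_square algebra_simps)
  moreover have "aint_dvd ((X (k + 2 + Suc j))\<^sup>2) (2 - X (Suc k))"
    using Suc[of "Suc k"] by simp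
  ultimately show ?case
    by (simp add: aint_dvd_mult algebraic_int_plus_times(1))
qed

lemma X_squared_aint_dvd_2:
  assumes "n > 0" shows "aint_dvd ((X n)\<^sup>2) 2"
proof (cases "n = 1")
  case True
  then show ?thesis using X_Suc_squared[of 0] by (auto intro!: aint_dvdI[of 1])
next
  case False
  then have "n = 0 + 2 + (n - 2)" using assms by simp
  then show ?thesis using X_squared_aint_dvd_2_minus_X[of 0 "n - 2"] by simp
qed

text \<open>Because the square of \<open>X (Suc n)\<close> divides 2, it divides \<open>X n\<close>,
  which is that square minus 2. Raising this to the power \<open>2 ^ n\<close> links consecutive
  layers. With \<open>aint_dvd_2_X_power\<close> it makes 2 and \<open>X n ^ 2 ^ n\<close>
  associates.\<close>

lemma X_power_aint_dvd_2:
  assumes "n > 0" shows "aint_dvd (X n ^ 2 ^ n) 2"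
  using assms
proof (induction n rule: nat_induct_non_zero)
  case 1
  then show ?case using X_Suc_squared[of 0] by (auto intro!: aint_dvdI[of 1])
next
  case (Suc n)
  obtain y where y: "algebraic_int y" "2 = (X (Suc n))\<^sup>2 * y"
    using X_squared_aint_dvd_2[of "Suc n"] unfolding aint_dvd_def by auto
  have "X n = (X (Suc n))\<^sup>2 * (1 - y)"
    using y(2) X_eq[of n] by (simp add: algebra_simps)
  then have "X n ^ 2 ^ n = X (Suc n) ^ 2 ^ Suc n * (1 - y) ^ 2 ^ n"
    by (simp add: power_mult_distrib power_mult[symmetric])
  then have "aint_dvd (X (Suc n) ^ 2 ^ Suc n) (X n ^ 2 ^ n)"
    using y(1) by (intro aint_dvdI[of "(1 - y) ^ 2 ^ n"] algebraic_int_power algebraic_int_diff) auto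
  then show ?case using Suc.IH by (rule aint_dvd_trans)
qed

text \<open>One power fewer would make \<open>X n ^ m\<close> divide \<open>X n ^ (m - 1)\<close>,
  so \<open>X n\<close> would be a unit; but then 2, which divides \<open>X n ^ m\<close>, would
  divide 1.\<close>

lemma not_aint_dvd_2_X_power:
  assumes "n > 0" shows "\<not> aint_dvd 2 (X n ^ (2 ^ n - 1))"
proof
  define m :: nat where "m = 2 ^ n"
  have m: "m = Suc (m - 1)" by (simp add: m_def)
  assume "aint_dvd 2 (X n ^ (2 ^ n - 1))"
  then have "aint_dvd (X n ^ m) (X n ^ (m - 1))"
    using X_power_aint_dvd_2[OF assms] aint_dvd_trans unfolding m_def by blast
  then obtain z where z: "algebraic_int z" "X n ^ (m - 1) = X n ^ m * z"
    unfolding aint_dvd_def by blast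
  have "X n ^ m = X n ^ (m - 1) * X n" by (subst m) simp
  then have "X n ^ (m - 1) * 1 = X n ^ (m - 1) * (X n * z)"
    using z(2) by (simp add: mult.assoc)
  then have "X n * z = 1"
    using X_pos[OF assms] by (subst (asm) mult_left_cancel) auto
  then have "X n ^ m * z ^ m = 1" by (simp flip: power_mult_distrib)
  moreover have "aint_dvd 2 (X n ^ m * z ^ m)"
    using z(1) aint_dvd_2_X_power[of n] unfolding m_def
    by (intro aint_dvd_mult algebraic_int_power) auto
  ultimately show False using not_aint_dvd_2_1 by simp
qed

text \<open>The argument of Eisenstein's criterion, with \<open>X n\<close> as a uniformizer above \<open>2\<close>: the
  first odd coefficient would make \<open>X n ^ (2 ^ n - 1)\<close> divisible by \<open>2\<close>.\<close>

lemma X_relation_even: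
  fixes p :: "int poly"
  assumes n: "n > 0" and deg: "degree p < 2 ^ n" and root: "poly (map_poly of_int p) (X n) = 0"
  shows "even (coeff p k)"
proof (rule ccontr)
  assume odd_k: "odd (coeff p k)"
  define m :: nat where "m = 2 ^ n"
  define l where "l = (LEAST k. odd (coeff p k))"
  have l: "odd (coeff p l)" unfolding l_def by (rule LeastI[of _ k]) (rule odd_k)
  have less: "even (coeff p i)" if "i < l" for i
    using not_less_Least[of i "\<lambda>k. odd (coeff p k)"] that by (auto simp: l_def)
  have "l \<le> degree p" using l by (intro le_degree) auto
  then have lm: "l < m" using deg by (simp add: m_def)
  \<comment> \<open>The factor \<open>X n ^ (m - 1 - l)\<close> brings the term with index
    \<open>l\<close> to exponent \<open>m - 1\<close>. Terms before it have even coefficients, and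
    terms after it contain \<open>X n ^ m\<close>; so all the others are divisible by 2.\<close>
  define t where "t i = of_int (coeff p i) * X n ^ (m - 1 - l + i)" for i
  have "0 = X n ^ (m - 1 - l) * poly (map_poly of_int p) (X n)" using root by simp
  also have "\<dots> = (\<Sum>i\<le>degree p. t i)"
    by (simp add: poly_altdef degree_map_poly coeff_map_poly sum_distrib_left t_def power_add mult_ac)
  also have "\<dots> = t l + (\<Sum>i\<in>{..degree p} - {l}. t i)"
    using \<open>l \<le> degree p\<close> by (subst sum.remove[of _ l]) auto
  finally have "t l = - (\<Sum>i\<in>{..degree p} - {l}. t i)" by simp
  moreover have "aint_dvd 2 (t i)" if i: "i \<noteq> l" for i
  proof (cases "i < l")
    case True
    then obtain d where "coeff p i = 2 * d" using less by blast
    then show ?thesis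
      by (intro aint_dvdI[of "of_int d * X n ^ (m - 1 - l + i)"] algebraic_int_closed)
        (auto simp: t_def)
  next
    case False
    then have "m - 1 - l + i = m + (i - l - 1)" using i lm by simp
    then have "t i = X n ^ m * (X n ^ (i - l - 1) * of_int (coeff p i))"
      unfolding t_def by (simp add: power_add)
    then show ?thesis using aint_dvd_2_X_power[of n] unfolding m_def
      by (auto intro!: aint_dvd_mult algebraic_int_closed)
  qed
  ultimately have "aint_dvd 2 (t l)" by (auto intro!: aint_dvd_minus aint_dvd_sum)
  moreover obtain d where "coeff p l = 2 * d + 1" using l by (elim oddE)
  then have "t l = 2 * (of_int d * X n ^ (m - 1)) + X n ^ (m - 1)"
    using lm by (simp add: t_def algebra_simps)
  moreover have "aint_dvd 2 (- (2 * (of_int d * X n ^ (m - 1))))"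
    by (intro aint_dvd_minus aint_dvdI[of "of_int d * X n ^ (m - 1)"] algebraic_int_closed) auto
  ultimately have "aint_dvd 2 (X n ^ (m - 1))"
    using aint_dvd_add[of 2 "t l" "- (2 * (of_int d * X n ^ (m - 1)))"] by simp
  then show False using not_aint_dvd_2_X_power[OF n] by (simp add: m_def)
qed

text \<open>Passing to the primitive part replaces a descent: evenness of all coefficients
  contradicts content 1 at once.\<close>

lemma X_int_independent:
  fixes p :: "int poly"
  assumes n: "n > 0" and deg: "degree p < 2 ^ n" and root: "poly (map_poly of_int p) (X n) = 0"
  shows "p = 0"
proof (rule ccontr)
  assume p: "p \<noteq> 0"
  define q where "q = primitive_part p"
  have pq: "p = Polynomial.smult (content p) q" by (simp add: q_def)
  have c0: "content p \<noteq> 0" using p by simp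
  have "degree q < 2 ^ n" using deg by (simp add: q_def)
  moreover have "poly (map_poly of_int q) (X n) = 0"
  proof -
    have "map_poly of_int p = Polynomial.smult (of_int (content p)) (map_poly real_of_int q)"
      by (subst pq) (simp add: poly_eq_iff coeff_map_poly)
    then show ?thesis using root c0 by simp
  qed
  ultimately have "2 dvd coeff q k" for k using X_relation_even[OF n] by blast
  then have "[:2:] dvd q" by (simp add: const_poly_dvd_iff)
  then have "2 dvd content q" by (simp add: const_poly_dvd_iff_dvd_content)
  moreover have "content q = 1" using p by (simp add: q_def)
  ultimately show False by simp
qed

text \<open>Coefficients stay in the type \<open>rat\<close>, so that division with remainder and
  Bezout combinations remain over the rationals although the argument is real.\<close>

definition rat_eval :: "rat poly \<Rightarrow> real \<Rightarrow> real" where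
  "rat_eval p x = poly (map_poly of_rat p) x"

lemma rat_eval_0 [simp]: "rat_eval 0 x = 0"
  by (simp add: rat_eval_def)

lemma rat_eval_pCons [simp]: "rat_eval (pCons a p) x = of_rat a + x * rat_eval p x"
  by (cases "a = 0 \<and> p = 0") (auto simp: rat_eval_def map_poly_pCons)

lemma rat_eval_1 [simp]: "rat_eval 1 x = 1"
  by (simp add: one_pCons)

lemma rat_eval_add [simp]: "rat_eval (p + q) x = rat_eval p x + rat_eval q x"
  by (induction p q rule: poly_induct2) (simp_all add: of_rat_add algebra_simps)

lemma rat_eval_smult [simp]: "rat_eval (Polynomial.smult a p) x = of_rat a * rat_eval p x"
  by (induction p) (simp_all add: of_rat_mult algebra_simps)

lemma rat_eval_minus [simp]: "rat_eval (- p) x = - rat_eval p x"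
  using rat_eval_smult[of "-1" p x] by simp

lemma rat_eval_diff [simp]: "rat_eval (p - q) x = rat_eval p x - rat_eval q x"
  using rat_eval_add[of p "- q" x] by simp

lemma rat_eval_mult [simp]: "rat_eval (p * q) x = rat_eval p x * rat_eval q x"
  by (induction p) (simp_all add: algebra_simps)

lemma rat_eval_pcompose [simp]: "rat_eval (pcompose p q) x = rat_eval p (rat_eval q x)"
  by (induction p) (simp_all add: pcompose_pCons)

lemma rat_poly_clear_denominators:
  fixes p :: "rat poly"
  obtains k q where "k \<noteq> (0::int)" "Polynomial.smult (of_int k) p = map_poly of_int q"
proof -
  have "\<exists>k q. k \<noteq> (0::int) \<and> Polynomial.smult (of_int k) p = map_poly of_int q"
  proof (induction p)
    case 0
    then show ?case by (intro exI[of _ 1] exI[of _ 0]) simp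
  next
    case (pCons a p)
    then obtain k q where k: "k \<noteq> 0" "Polynomial.smult (of_int k) p = map_poly of_int q" by blast
    obtain c d where a: "d \<noteq> 0" "a = of_int c / of_int d"
      by (metis Fract_of_int_quotient Rat_cases less_irrefl)
    have "Polynomial.smult (of_int (k * d)) (pCons a p) = map_poly of_int (pCons (k * c) (Polynomial.smult d q))"
    proof -
      have "Polynomial.smult (of_int (k * d)) p = map_poly of_int (Polynomial.smult d q)"
      proof -
        have "Polynomial.smult (of_int (k * d)) p = Polynomial.smult (of_int d) (Polynomial.smult (of_int k) p)"
          by (simp add: mult.commute)
        also have "\<dots> = map_poly of_int (Polynomial.smult d q)"
          unfolding k(2) by (simp add: poly_eq_iff coeff_map_poly)
        finally show ?thesis .
      qed
      then show ?thesis using a by (auto simp add: poly_eq_iff coeff_map_poly coeff_pCons split: nat.splits)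
    qed
    then show ?case using k(1) a(1) by (metis mult_eq_0_iff)
  qed
  then show ?thesis using that by blast
qed

lemma X_rat_independent:
  assumes n: "n > 0" and deg: "degree p < 2 ^ n" and root: "rat_eval p (X n) = 0"
  shows "p = 0"
proof -
  obtain k q where k: "k \<noteq> (0::int)" "Polynomial.smult (of_int k) p = map_poly of_int q"
    using rat_poly_clear_denominators by blast
  have "map_poly (of_rat :: rat \<Rightarrow> real) (map_poly of_int q) = map_poly of_int q"
    by (simp add: poly_eq_iff coeff_map_poly)
  then have "poly (map_poly of_int q) (X n) = rat_eval (Polynomial.smult (of_int k) p) (X n)"
    unfolding rat_eval_def k(2) by simp
  also have "\<dots> = 0" using root by simp
  finally have root_q: "poly (map_poly of_int q) (X n) = 0" .
  have "degree q = degree (map_poly rat_of_int q)" by (simp add: degree_map_poly)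
  also have "\<dots> = degree p" using k by (simp flip: k(2))
  finally have "q = 0" using X_int_independent[OF n _ root_q] deg by simp
  then show ?thesis using k by simp
qed

section \<open>The fields and their automorphisms\<close>

text \<open>Integer indices allow reflection and shifts by periods. At index 0 the value is 2,
  unlike \<open>b n 0 = 1\<close>.\<close>

definition two_cos :: "nat \<Rightarrow> int \<Rightarrow> real" where
  "two_cos n i = 2 * cos (of_int i * (2 * pi / 2 ^ (n + 2)))"

lemma two_cos_0 [simp]: "two_cos n 0 = 2"
  by (simp add: two_cos_def)

lemma two_cos_1 [simp]: "two_cos n 1 = X n"
  by (simp add: two_cos_def X_def)

lemma two_cos_minus [simp]: "two_cos n (- i) = two_cos n i"
  by (simp add: two_cos_def)

lemma two_cos_mult: "two_cos n i * two_cos n j = two_cos n (i + j) + two_cos n (i - j)"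
proof -
  have *: "2 * cos x * (2 * cos y) = 2 * cos (x + y) + 2 * cos (x - y)" for x y :: real
    by (simp add: cos_add cos_diff)
  show ?thesis
    unfolding two_cos_def of_int_add of_int_diff distrib_right left_diff_distrib by (rule *)
qed

lemma two_cos_add_half [simp]: "two_cos n (i + 2 ^ (n + 1)) = - two_cos n i"
proof -
  have "of_int (i + 2 ^ (n + 1)) * (2 * pi / 2 ^ (n + 2)) = of_int i * (2 * pi / 2 ^ (n + 2)) + pi"
    by (simp add: field_simps)
  then show ?thesis by (simp add: two_cos_def)
qed

lemma two_cos_add_period [simp]: "two_cos n (i + k * 2 ^ (n + 2)) = two_cos n i"
proof -
  have "of_int (i + k * 2 ^ (n + 2)) * (2 * pi / 2 ^ (n + 2))
      = of_int i * (2 * pi / 2 ^ (n + 2)) + 2 * pi * of_int k"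
    by (simp add: field_simps)
  then show ?thesis by (simp add: two_cos_def cos_add cos_int_2pin sin_int_2pin)
qed

lemma two_cos_Suc_double: "two_cos (Suc n) (2 * i) = two_cos n i"
  by (simp add: two_cos_def field_simps)

lemma b_eq_two_cos: "i > 0 \<Longrightarrow> b n i = two_cos n (int i)"
  by (simp add: b_def two_cos_def)

text \<open>The minimal polynomial of \<open>X n\<close> for positive \<open>n\<close>: it sends
  \<open>2 * cos x\<close> to \<open>2 * cos (2 ^ n * x)\<close>, a rescaled Chebyshev
  polynomial.\<close>

primrec layer_poly :: "nat \<Rightarrow> rat poly" where
  "layer_poly 0 = [:0, 1:]"
| "layer_poly (Suc n) = pcompose (layer_poly n) [:-2, 0, 1:]"

lemma degree_layer_poly [simp]: "degree (layer_poly n) = 2 ^ n"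
  by (induction n) simp_all

lemma layer_poly_nonzero [simp]: "layer_poly n \<noteq> 0"
  using degree_layer_poly[of n] by (metis degree_0 power_not_zero zero_neq_numeral)

text \<open>A root one layer up is determined up to sign by its square, and the sign is absorbed by
  shifting the index by half a period, an even number, so the index stays odd.\<close>

lemma layer_poly_root_iff:
  "rat_eval (layer_poly n) x = 0 \<longleftrightarrow> (\<exists>j. odd j \<and> x = two_cos n j)"
proof (induction n arbitrary: x)
  case 0
  have "two_cos 0 j = 0" if "odd j" for j
  proof -
    obtain i where "j = 2 * i + 1" using \<open>odd j\<close> by (elim oddE)
    then have "of_int j * (2 * pi / 2 ^ (0 + 2)) = of_int i * pi + pi / 2"
      by (simp add: field_simps)
    then have "cos (of_int j * (2 * pi / 2 ^ (0 + 2))) = 0"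
      by (simp only: cos_add cos_pi_half sin_pi_half) (simp add: mult.commute)
    then show ?thesis unfolding two_cos_def by simp
  qed
  then have "(\<exists>j. odd j \<and> x = two_cos 0 j) \<longleftrightarrow> x = 0" by (metis odd_one)
  then show ?case by simp
next
  case (Suc n)
  have sq: "(two_cos (Suc n) j)\<^sup>2 = two_cos n j + 2" for j
    unfolding power2_eq_square two_cos_mult mult_2[symmetric] two_cos_Suc_double by simp
  have "rat_eval (layer_poly (Suc n)) x = rat_eval (layer_poly n) (x\<^sup>2 - 2)"
    by (simp add: power2_eq_square of_rat_minus)
  then have "rat_eval (layer_poly (Suc n)) x = 0 \<longleftrightarrow> (\<exists>j. odd j \<and> x\<^sup>2 = (two_cos (Suc n) j)\<^sup>2)"
    by (simp only: Suc.IH sq diff_eq_eq)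
  also have "\<dots> \<longleftrightarrow> (\<exists>j. odd j \<and> x = two_cos (Suc n) j)"
  proof
    assume "\<exists>j. odd j \<and> x\<^sup>2 = (two_cos (Suc n) j)\<^sup>2"
    then obtain j where j: "odd j" "x\<^sup>2 = (two_cos (Suc n) j)\<^sup>2" by blast
    then have "x = two_cos (Suc n) j \<or> x = two_cos (Suc n) (j + 2 ^ (Suc n + 1))"
      unfolding two_cos_add_half by (simp add: power2_eq_iff)
    moreover have "odd (j + 2 ^ (Suc n + 1))" using j(1) by simp
    ultimately show "\<exists>j. odd j \<and> x = two_cos (Suc n) j" using j(1) by blast
  qed auto
  finally show ?case .
qed

lemma layer_poly_X [simp]: "rat_eval (layer_poly n) (X n) = 0"
  by (auto simp: layer_poly_root_iff intro!: exI[of _ 1])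

lemma rat_eval_X_eq_0_iff:
  assumes "n > 0"
  shows "rat_eval p (X n) = 0 \<longleftrightarrow> layer_poly n dvd p"
proof
  assume 0: "rat_eval p (X n) = 0"
  define r where "r = p mod layer_poly n"
  have "p = layer_poly n * (p div layer_poly n) + r" by (simp add: r_def)
  then have "rat_eval p (X n) = rat_eval (layer_poly n * (p div layer_poly n) + r) (X n)" by simp
  then have "rat_eval r (X n) = 0" using 0 by simp
  moreover have "degree r < 2 ^ n \<or> r = 0"
    using degree_mod_less[of "layer_poly n" p] by (auto simp: r_def)
  ultimately have "r = 0" using X_rat_independent[OF assms] by blast
  then show "layer_poly n dvd p" by (simp add: r_def dvd_eq_mod_eq_0)
qed (auto elim!: dvdE)

text \<open>This makes the substitution of \<open>two_cos n j\<close> for \<open>X n\<close> well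
  defined on polynomial values.\<close>

lemma rat_eval_eq_conjugate:
  assumes "n > 0" "odd j" "rat_eval p (X n) = rat_eval q (X n)"
  shows "rat_eval p (two_cos n j) = rat_eval q (two_cos n j)"
proof -
  have "layer_poly n dvd p - q"
    using assms by (simp flip: rat_eval_X_eq_0_iff)
  then obtain r where "p - q = layer_poly n * r" by blast
  then have "rat_eval (p - q) (two_cos n j) = rat_eval (layer_poly n) (two_cos n j) * rat_eval r (two_cos n j)"
    by (simp only: rat_eval_mult)
  moreover have "rat_eval (layer_poly n) (two_cos n j) = 0"
    using assms(2) by (auto simp: layer_poly_root_iff)
  ultimately show ?thesis by simp
qed

lemma field_poly_bezout:
  fixes p q :: "'a::field poly"
  assumes "q \<noteq> 0"
  obtains g s t where "g \<noteq> 0" "g dvd p" "g dvd q" "g = s * p + t * q"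
proof -
  define I where "I = {s * p + t * q |s t. True}"
  have "q \<in> I" unfolding I_def by (auto intro: exI[of _ 0] exI[of _ 1])
  then obtain g where g: "g \<in> I" "g \<noteq> 0"
    and minimal: "\<And>h. h \<in> I \<Longrightarrow> h \<noteq> 0 \<Longrightarrow> degree g \<le> degree h"
    using ex_has_least_nat[of "\<lambda>g. g \<in> I \<and> g \<noteq> 0" q degree] assms by blast
  obtain s t where st: "g = s * p + t * q" using g(1) by (auto simp: I_def)
  have dvd: "g dvd h" if "h \<in> I" for h
  proof (rule ccontr)
    assume "\<not> g dvd h"
    then have nz: "h mod g \<noteq> 0" by (simp add: dvd_eq_mod_eq_0)
    obtain v w where "h = v * p + w * q" using \<open>h \<in> I\<close> by (auto simp: I_def)
    then have "h mod g = (v - h div g * s) * p + (w - h div g * t) * q"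
      by (simp add: minus_div_mult_eq_mod[symmetric] st algebra_simps)
    then have "h mod g \<in> I" unfolding I_def by blast
    then have "degree g \<le> degree (h mod g)" using nz by (rule minimal)
    then show False using degree_mod_less[OF g(2), of h] nz by simp
  qed
  have "p \<in> I" unfolding I_def by (auto intro: exI[of _ 1] exI[of _ 0])
  then show ?thesis using that[OF g(2) dvd dvd st] \<open>q \<in> I\<close> by blast
qed

text \<open>The common divisor \<open>g\<close> of \<open>p\<close> and
  \<open>layer_poly n = g * h\<close> does not vanish at \<open>X n\<close>, so \<open>h\<close>
  does, and \<open>layer_poly n\<close> divides \<open>h\<close>. Comparing degrees leaves
  \<open>g\<close> constant, and the Bezout combination becomes an inverse.\<close>

lemma rat_eval_X_inverse:
  assumes n: "n > 0" and p: "rat_eval p (X n) \<noteq> 0"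
  shows "\<exists>q. rat_eval q (X n) = inverse (rat_eval p (X n))"
proof -
  obtain g t w where g: "g dvd p" "g dvd layer_poly n" "g = t * p + w * layer_poly n"
    using field_poly_bezout[of "layer_poly n" p] layer_poly_nonzero by metis
  obtain h where h: "layer_poly n = g * h" using g(2) by blast
  obtain s where s: "p = g * s" using g(1) by blast
  have gX: "rat_eval g (X n) \<noteq> 0" using p by (auto simp: s)
  moreover have "rat_eval g (X n) * rat_eval h (X n) = 0"
    using layer_poly_X[of n] by (simp only: h rat_eval_mult)
  ultimately have "layer_poly n dvd h" using rat_eval_X_eq_0_iff[OF n] by simp
  moreover have gh: "g \<noteq> 0" "h \<noteq> 0" using layer_poly_nonzero[of n] unfolding h by auto
  ultimately have "degree (layer_poly n) \<le> degree h" by (intro dvd_imp_degree_le)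
  then have "degree g = 0" using gh unfolding h by (simp add: degree_mult_eq)
  then obtain a where a: "g = [:a:]" by (elim degree_eq_zeroE)
  then have "rat_eval (t * p + w * layer_poly n) (X n) = of_rat a" by (simp flip: g(3))
  then have ta: "rat_eval t (X n) * rat_eval p (X n) = of_rat a" by simp
  have "a \<noteq> 0" using gX a by auto
  then have "rat_eval (Polynomial.smult (inverse a) t) (X n) * rat_eval p (X n) = 1"
    using ta by (simp add: of_rat_inverse mult.assoc)
  then have "rat_eval (Polynomial.smult (inverse a) t) (X n) = inverse (rat_eval p (X n))"
    using p by (metis nonzero_mult_div_cancel_right inverse_eq_divide)
  then show ?thesis by blast
qed

section \<open>Real subfields, and the layer as the ring of polynomial values at
  \<open>X n\<close>\<close>

lemma real_subfield_closed:
  assumes "real_subfield K"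
  shows "0 \<in> K" "1 \<in> K" "x \<in> K \<Longrightarrow> y \<in> K \<Longrightarrow> x - y \<in> K" "x \<in> K \<Longrightarrow> y \<in> K \<Longrightarrow> x * y \<in> K"
    "x \<in> K \<Longrightarrow> inverse x \<in> K" "x \<in> K \<Longrightarrow> - x \<in> K" "x \<in> K \<Longrightarrow> y \<in> K \<Longrightarrow> x + y \<in> K"
    "x \<in> K \<Longrightarrow> y \<in> K \<Longrightarrow> x / y \<in> K"
proof -
  have *: "1 \<in> K" "\<And>x y. x \<in> K \<Longrightarrow> y \<in> K \<Longrightarrow> x - y \<in> K"
    "\<And>x y. x \<in> K \<Longrightarrow> y \<in> K \<Longrightarrow> x * y \<in> K" "\<And>x. x \<in> K \<Longrightarrow> inverse x \<in> K"
    using assms unfolding real_subfield_def by blast+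
  have zero: "0 \<in> K" using *(2)[OF *(1) *(1)] by simp
  have minus: "- x \<in> K" if "x \<in> K" for x using *(2)[OF zero that] by simp
  have plus: "x + y \<in> K" if "x \<in> K" "y \<in> K" for x y using *(2)[OF that(1) minus[OF that(2)]] by simp
  have divide: "x / y \<in> K" if "x \<in> K" "y \<in> K" for x y
    using *(3)[OF that(1) *(4)[OF that(2)]] by (simp add: divide_inverse)
  show "0 \<in> K" "1 \<in> K" "x \<in> K \<Longrightarrow> y \<in> K \<Longrightarrow> x - y \<in> K" "x \<in> K \<Longrightarrow> y \<in> K \<Longrightarrow> x * y \<in> K"
    "x \<in> K \<Longrightarrow> inverse x \<in> K" "x \<in> K \<Longrightarrow> - x \<in> K" "x \<in> K \<Longrightarrow> y \<in> K \<Longrightarrow> x + y \<in> K"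
    "x \<in> K \<Longrightarrow> y \<in> K \<Longrightarrow> x / y \<in> K"
    by (simp_all only: * zero minus plus divide)
qed

lemma Rats_subset_real_subfield:
  assumes "real_subfield K" shows "\<rat> \<subseteq> K"
proof
  note closed = real_subfield_closed[OF assms]
  have nat: "of_nat k \<in> K" for k by (induction k) (auto intro: closed)
  have int: "of_int k \<in> K" for k
    by (cases k rule: int_cases2) (auto intro: closed nat)
  fix x :: real assume "x \<in> \<rat>"
  then obtain i j where "x = of_int i / of_int j" by (auto elim: Rats_cases')
  then show "x \<in> K" by (auto intro: closed int)
qed

lemma rat_eval_in_real_subfield:
  assumes "real_subfield K" "x \<in> K" shows "rat_eval p x \<in> K"
proof (induction p)
  case 0
  then show ?case using real_subfield_closed[OF assms(1)] by simp
next
  case (pCons a p)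
  have "of_rat a \<in> K" using Rats_subset_real_subfield[OF assms(1)] by auto
  then show ?case using pCons(2) assms by (auto intro: real_subfield_closed)
qed

lemma real_subfield_BB: "real_subfield (BB n)"
  unfolding BB_def by (rule hull_in) (fastforce simp: real_subfield_def)

lemma X_in_BB: "X n \<in> BB n"
  unfolding BB_def by (rule hull_inc) simp

lemma rat_eval_in_BB: "x \<in> BB n \<Longrightarrow> rat_eval p x \<in> BB n"
  using rat_eval_in_real_subfield[OF real_subfield_BB] .

lemma BB_eq:
  assumes "n > 0" shows "BB n = range (\<lambda>p. rat_eval p (X n))"
proof
  have "real_subfield (range (\<lambda>p. rat_eval p (X n)))"
    unfolding real_subfield_def
  proof (intro conjI ballI)
    show "1 \<in> range (\<lambda>p. rat_eval p (X n))" by (rule range_eqI[of _ _ 1]) simp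
  next
    fix x y assume "x \<in> range (\<lambda>p. rat_eval p (X n))" "y \<in> range (\<lambda>p. rat_eval p (X n))"
    then obtain p q where "x = rat_eval p (X n)" "y = rat_eval q (X n)" by blast
    then show "x - y \<in> range (\<lambda>p. rat_eval p (X n))" "x * y \<in> range (\<lambda>p. rat_eval p (X n))"
      by (auto intro: range_eqI[of _ _ "p - q"] range_eqI[of _ _ "p * q"])
  next
    fix x assume "x \<in> range (\<lambda>p. rat_eval p (X n))"
    then obtain p where p: "x = rat_eval p (X n)" by blast
    show "inverse x \<in> range (\<lambda>p. rat_eval p (X n))"
    proof (cases "x = 0")
      case True
      then show ?thesis by (auto intro!: range_eqI[of _ _ 0])
    next
      case False
      then show ?thesis using rat_eval_X_inverse[OF assms] unfolding p by (metis rangeI)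
    qed
  qed
  moreover have "X n \<in> range (\<lambda>p. rat_eval p (X n))"
    by (rule range_eqI[of _ _ "[:0, 1:]"]) simp
  ultimately show "BB n \<subseteq> range (\<lambda>p. rat_eval p (X n))"
    unfolding BB_def by (intro hull_minimal) auto
qed (auto intro: rat_eval_in_BB X_in_BB)

lemma BB_cases:
  assumes "n > 0" "x \<in> BB n" obtains p where "x = rat_eval p (X n)"
  using assms BB_eq by blast

text \<open>Normalized as \<open>2 * T_k (x / 2)\<close>, so that it multiplies the index of
  \<open>two_cos\<close> by \<open>k\<close>.\<close>

fun chebyshev :: "nat \<Rightarrow> rat poly" where
  "chebyshev 0 = [:2:]"
| "chebyshev (Suc 0) = [:0, 1:]"
| "chebyshev (Suc (Suc k)) = [:0, 1:] * chebyshev (Suc k) - chebyshev k"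

lemma rat_eval_chebyshev: "rat_eval (chebyshev k) (two_cos n j) = two_cos n (int k * j)"
proof (induction k rule: chebyshev.induct)
  case (3 k)
  have "two_cos n j * two_cos n (int (Suc k) * j)
      = two_cos n (int (Suc (Suc k)) * j) + two_cos n (int k * j)"
    using two_cos_mult[of n "int (Suc k) * j" j] by (simp add: algebra_simps)
  then show ?case using 3 by simp
qed simp_all

lemma two_cos_eq_rat_eval: "two_cos n (i * j) = rat_eval (chebyshev (nat \<bar>i\<bar>)) (two_cos n j)"
proof -
  have "two_cos n (i * j) = two_cos n (\<bar>i\<bar> * j)" by (auto simp: abs_if)
  then show ?thesis by (simp add: rat_eval_chebyshev)
qed

lemma two_cos_in_BB [simp]: "two_cos n i \<in> BB n"
  using two_cos_eq_rat_eval[of n i 1] rat_eval_in_BB[OF X_in_BB] by simp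

text \<open>For odd \<open>j\<close> the choice of the representing polynomial does not affect the
  value when \<open>n > 0\<close>. Restriction supplies the extensionality that \<open>Bij\<close>
  demands.\<close>

definition gal_map :: "nat \<Rightarrow> int \<Rightarrow> real \<Rightarrow> real" where
  "gal_map n j = restrict (\<lambda>x. rat_eval (SOME p. rat_eval p (X n) = x) (two_cos n j)) (BB n)"

lemma gal_map_cong: "two_cos n i = two_cos n j \<Longrightarrow> gal_map n i = gal_map n j"
  by (simp add: gal_map_def)

context
  fixes n :: nat
  assumes n: "n > 0"
begin

lemma gal_map_rat_eval:
  assumes "odd j"
  shows "gal_map n j (rat_eval p (X n)) = rat_eval p (two_cos n j)"
proof -
  define q where "q = (SOME q. rat_eval q (X n) = rat_eval p (X n))"
  have "rat_eval q (X n) = rat_eval p (X n)" unfolding q_def by (rule someI[of _ p]) simp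
  then have "rat_eval q (two_cos n j) = rat_eval p (two_cos n j)"
    by (rule rat_eval_eq_conjugate[OF n assms])
  then show ?thesis
    unfolding gal_map_def q_def by (simp add: rat_eval_in_BB X_in_BB)
qed

lemma gal_map_two_cos:
  assumes "odd j" shows "gal_map n j (two_cos n i) = two_cos n (i * j)"
  using gal_map_rat_eval[OF assms, of "chebyshev (nat \<bar>i\<bar>)"]
    two_cos_eq_rat_eval[of n i 1] two_cos_eq_rat_eval[of n i j] by simp

lemma gal_map_X: "odd j \<Longrightarrow> gal_map n j (X n) = two_cos n j"
  using gal_map_two_cos[of j 1] by simp

lemma gal_map_in_BB:
  assumes "odd j" "x \<in> BB n" shows "gal_map n j x \<in> BB n"
  using assms BB_cases[OF n] by (metis gal_map_rat_eval rat_eval_in_BB two_cos_in_BB)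

lemma gal_map_comp:
  assumes "odd i" "odd j" "x \<in> BB n"
  shows "gal_map n i (gal_map n j x) = gal_map n (i * j) x"
proof -
  obtain p where p: "x = rat_eval p (X n)" using BB_cases[OF n assms(3)] .
  \<comment> \<open>The image is rewritten as a polynomial in \<open>X n\<close>, the only form in
    which the outer map can be evaluated.\<close>
  have "gal_map n j x = rat_eval (pcompose p (chebyshev (nat \<bar>j\<bar>))) (X n)"
    using two_cos_eq_rat_eval[of n j 1] by (simp add: p gal_map_rat_eval[OF assms(2)])
  then have "gal_map n i (gal_map n j x) = rat_eval (pcompose p (chebyshev (nat \<bar>j\<bar>))) (two_cos n i)"
    by (simp only: gal_map_rat_eval[OF assms(1)])
  also have "\<dots> = rat_eval p (two_cos n (j * i))"
    by (simp only: two_cos_eq_rat_eval[of n j i] rat_eval_pcompose)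
  finally have "gal_map n i (gal_map n j x) = rat_eval p (two_cos n (j * i))" .
  then show ?thesis using assms by (simp add: p gal_map_rat_eval mult.commute)
qed

lemma gal_map_id:
  assumes "two_cos n j = X n" "x \<in> BB n" shows "gal_map n j x = x"
proof -
  have "gal_map n j = gal_map n 1" using assms(1) by (intro gal_map_cong) simp
  moreover obtain p where "x = rat_eval p (X n)" using BB_cases[OF n assms(2)] .
  ultimately show ?thesis by (simp add: gal_map_rat_eval)
qed

text \<open>The inverse of \<open>j\<close> modulo \<open>2 ^ (n + 2)\<close>, from Bezout; it is
  odd because the modulus is even. It supplies bijectivity of \<open>gal_map n j\<close>.\<close>

lemma gal_map_inverse:
  assumes "odd j"
  obtains i where "odd i" "two_cos n (i * j) = X n"
proof -
  have "coprime j (2 ^ (n + 2))" using assms by (intro coprime_power_right_iff[THEN iffD2]) simp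
  moreover obtain s t where "s * j + t * 2 ^ (n + 2) = gcd j (2 ^ (n + 2))"
    using bezout_int by blast
  ultimately have st: "s * j + t * 2 ^ (n + 2) = 1" by simp
  have "odd s"
  proof
    assume "even s"
    then have "even (s * j + t * 2 ^ (n + 2))" by simp
    then show False unfolding st by simp
  qed
  moreover have "two_cos n (s * j) = X n"
    using two_cos_add_period[of n "s * j" t] unfolding st by simp
  ultimately show ?thesis using that by blast
qed

lemma gal_map_in_Gal:
  assumes "odd j" shows "gal_map n j \<in> Gal (BB n) \<rat>"
proof -
  obtain i where i: "odd i" "two_cos n (i * j) = X n" using gal_map_inverse[OF assms] .
  have "gal_map n i (gal_map n j x) = x" "gal_map n j (gal_map n i x) = x" if "x \<in> BB n" for x
    using that i assms by (simp_all add: gal_map_comp gal_map_id mult.commute)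
  then have "bij_betw (gal_map n j) (BB n) (BB n)"
    using i assms by (intro bij_betw_byWitness[where f' = "gal_map n i"]) (auto intro: gal_map_in_BB)
  then have "gal_map n j \<in> Bij (BB n)" by (simp add: Bij_def gal_map_def)
  moreover have "gal_map n j (x + y) = gal_map n j x + gal_map n j y"
    "gal_map n j (x * y) = gal_map n j x * gal_map n j y" if xy: "x \<in> BB n" "y \<in> BB n" for x y
  proof -
    obtain p q where "x = rat_eval p (X n)" "y = rat_eval q (X n)"
      using BB_cases[OF n] xy by metis
    then show "gal_map n j (x + y) = gal_map n j x + gal_map n j y"
      "gal_map n j (x * y) = gal_map n j x * gal_map n j y"
      using assms gal_map_rat_eval[OF assms, of "p + q"] gal_map_rat_eval[OF assms, of "p * q"]
      by (simp_all add: gal_map_rat_eval)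
  qed
  moreover have "gal_map n j x = x" if x: "x \<in> \<rat>" for x
  proof -
    obtain a where "x = of_rat a" using x by (auto elim: Rats_cases)
    then show ?thesis using gal_map_rat_eval[OF assms, of "[:a:]"] by simp
  qed
  ultimately show ?thesis by (simp add: Gal_def)
qed

lemma Gal_rat_eval:
  assumes "\<tau> \<in> Gal (BB n) \<rat>" "x \<in> BB n"
  shows "\<tau> (rat_eval p x) = rat_eval p (\<tau> x)"
proof (induction p)
  case 0
  have "\<tau> 0 = 0" using assms(1) by (simp add: Gal_def)
  then show ?case by simp
next
  case (pCons a p)
  have hom: "\<tau> (y + z) = \<tau> y + \<tau> z" "\<tau> (y * z) = \<tau> y * \<tau> z" if "y \<in> BB n" "z \<in> BB n" for y z
    using assms(1) that by (auto simp: Gal_def)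
  have rat: "\<tau> (of_rat a) = of_rat a" using assms(1) by (simp add: Gal_def)
  have "of_rat a \<in> BB n" using Rats_subset_real_subfield[OF real_subfield_BB, of n] by auto
  moreover have "x * rat_eval p x \<in> BB n"
    using assms(2) by (intro real_subfield_closed[OF real_subfield_BB] rat_eval_in_BB)
  ultimately show ?case
    using pCons(2) hom rat assms(2) by (simp add: rat_eval_in_BB)
qed

lemma Gal_eqI:
  assumes "\<tau> \<in> Gal (BB n) \<rat>" "\<rho> \<in> Gal (BB n) \<rat>" "\<tau> (X n) = \<rho> (X n)"
  shows "\<tau> = \<rho>"
proof (rule extensionalityI[of _ "BB n"])
  show "\<tau> \<in> extensional (BB n)" "\<rho> \<in> extensional (BB n)"
    using assms by (simp_all add: Gal_def Bij_def)
  fix x assume "x \<in> BB n"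
  then obtain p where "x = rat_eval p (X n)" using BB_cases[OF n] by blast
  then show "\<tau> x = \<rho> x"
    using Gal_rat_eval[OF assms(1) X_in_BB] Gal_rat_eval[OF assms(2) X_in_BB] assms(3) by simp
qed

text \<open>The image of \<open>X n\<close> is again a root of \<open>layer_poly n\<close>, and it
  determines the automorphism.\<close>

lemma Gal_cases:
  assumes "\<tau> \<in> Gal (BB n) \<rat>"
  obtains j where "odd j" "\<tau> = gal_map n j"
proof -
  have "rat_eval (layer_poly n) (\<tau> (X n)) = 0"
    using Gal_rat_eval[OF assms X_in_BB, of "layer_poly n"] assms by (simp add: Gal_def)
  then obtain j where j: "odd j" "\<tau> (X n) = two_cos n j"
    unfolding layer_poly_root_iff by blast
  then have "\<tau> = gal_map n j"
    by (intro Gal_eqI[OF assms gal_map_in_Gal[OF j(1)]]) (simp add: gal_map_X)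
  then show ?thesis using that j by blast
qed

lemma two_cos_odd_representative:
  assumes "odd j"
  obtains k where "k < 2 ^ n" "two_cos n j = two_cos n (2 * int k + 1)"
proof -
  define N :: int where "N = 2 ^ (n + 2)"
  have N: "N = 4 * 2 ^ n" "even N" "N > 0" by (simp_all add: N_def)
  define r where "r = j mod N"
  have r: "0 \<le> r" "r < N" "odd r"
    using N assms by (simp_all add: r_def dvd_mod_iff)
  have j: "two_cos n j = two_cos n r"
  proof -
    have "j = r + (j div N) * 2 ^ (n + 2)" unfolding r_def N_def by (simp only: mod_mult_div_eq add.commute mult.commute mod_div_mult_eq)
    then show ?thesis by (metis two_cos_add_period)
  qed
  \<comment> \<open>Cosine is even, so the second half of the period folds onto the first. The
    border \<open>2 * 2 ^ n\<close> is even and hence differs from \<open>r\<close>.\<close>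
  define s where "s = (if r < 2 * 2 ^ n then r else N - r)"
  have rs: "two_cos n r = two_cos n s"
  proof -
    have "two_cos n (N - r) = two_cos n (- r)"
      using two_cos_add_period[of n "- r" 1] by (simp add: N_def)
    then show ?thesis by (simp add: s_def)
  qed
  have s: "odd s" "0 < s" "s < 2 * 2 ^ n"
  proof -
    show "odd s" using r N by (simp add: s_def)
    moreover have "r \<noteq> 2 * 2 ^ n" using r(3) by auto
    ultimately show "0 < s" "s < 2 * 2 ^ n"
      using r N by (auto simp: s_def intro: le_neq_trans)
  qed
  obtain k where k: "s = 2 * k + 1" using s(1) by (elim oddE)
  then have "0 \<le> k" "k < 2 ^ n" using s by simp_all
  then have "nat k < 2 ^ n" "two_cos n j = two_cos n (2 * int (nat k) + 1)"
    using j rs k by (simp_all add: nat_less_iff)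
  then show ?thesis using that by blast
qed

text \<open>All the angles lie between 0 and pi, where cosine is injective.\<close>

lemma inj_on_two_cos_odd: "inj_on (\<lambda>k. two_cos n (2 * int k + 1)) {..<2 ^ n}"
proof (rule inj_onI)
  fix k l :: nat
  assume kl: "k \<in> {..<2 ^ n}" "l \<in> {..<2 ^ n}"
    and eq: "two_cos n (2 * int k + 1) = two_cos n (2 * int l + 1)"
  have range: "0 \<le> of_int (2 * int i + 1) * (2 * pi / 2 ^ (n + 2)) \<and>
      of_int (2 * int i + 1) * (2 * pi / 2 ^ (n + 2)) \<le> pi" if "i \<in> {..<2 ^ n}" for i
  proof -
    have "i + 1 \<le> 2 ^ n" using that by simp
    then have "real (i + 1) \<le> real (2 ^ n)" by (rule of_nat_mono)
    then have "real_of_int (2 * int i + 1) \<le> 2 * 2 ^ n" by simp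
    then have "real_of_int (2 * int i + 1) * (2 * pi / 2 ^ (n + 2)) \<le> 2 * 2 ^ n * (2 * pi / 2 ^ (n + 2))"
      by (intro mult_right_mono) auto
    then show ?thesis by simp
  qed
  have "of_int (2 * int k + 1) * (2 * pi / 2 ^ (n + 2)) = of_int (2 * int l + 1) * (2 * pi / 2 ^ (n + 2))"
  proof (rule cos_inj_pi)
    show "cos (of_int (2 * int k + 1) * (2 * pi / 2 ^ (n + 2)))
        = cos (of_int (2 * int l + 1) * (2 * pi / 2 ^ (n + 2)))"
      using eq unfolding two_cos_def by linarith
  qed (use range[OF kl(1)] range[OF kl(2)] in blast)+
  then show "k = l" by simp
qed

lemma bij_betw_Gal: "bij_betw (\<lambda>k. gal_map n (2 * int k + 1)) {..<2 ^ n} (Gal (BB n) \<rat>)"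
  unfolding bij_betw_def
proof
  show "inj_on (\<lambda>k. gal_map n (2 * int k + 1)) {..<2 ^ n}"
  proof (rule inj_onI)
    fix k l :: nat
    assume kl: "k \<in> {..<2 ^ n}" "l \<in> {..<2 ^ n}"
      and "gal_map n (2 * int k + 1) = gal_map n (2 * int l + 1)"
    then have "two_cos n (2 * int k + 1) = two_cos n (2 * int l + 1)"
      using gal_map_X[of "2 * int k + 1"] gal_map_X[of "2 * int l + 1"] by simp
    then show "k = l" using inj_onD[OF inj_on_two_cos_odd] kl by blast
  qed
  show "(\<lambda>k. gal_map n (2 * int k + 1)) ` {..<2 ^ n} = Gal (BB n) \<rat>"
  proof
    show "Gal (BB n) \<rat> \<subseteq> (\<lambda>k. gal_map n (2 * int k + 1)) ` {..<2 ^ n}"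
    proof
      fix \<tau> assume "\<tau> \<in> Gal (BB n) \<rat>"
      then obtain j where j: "odd j" "\<tau> = gal_map n j" by (rule Gal_cases)
      obtain k where "k < 2 ^ n" "two_cos n j = two_cos n (2 * int k + 1)"
        using two_cos_odd_representative[OF j(1)] .
      then show "\<tau> \<in> (\<lambda>k. gal_map n (2 * int k + 1)) ` {..<2 ^ n}"
        using j(2) gal_map_cong by blast
    qed
  qed (auto intro: gal_map_in_Gal)
qed

lemma Tr_eq_sum: "Tr n x = (\<Sum>k<2 ^ n. gal_map n (2 * int k + 1) x)"
  unfolding rel_trace_def using sum.reindex_bij_betw[OF bij_betw_Gal, of "\<lambda>\<tau>. \<tau> x"] by simp

end

section \<open>Trace, relative norm and the generator of the Galois group\<close>

lemma sin_times_sum_cos_odd: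
  fixes t :: real
  shows "sin t * (\<Sum>k<m. 2 * cos ((2 * real k + 1) * t)) = sin (2 * real m * t)"
proof (induction m)
  case (Suc m)
  have prod: "2 * (sin t * cos x) = sin (x + t) - sin (x - t)" for x
    by (simp add: sin_add sin_diff)
  have "sin t * (2 * cos ((2 * real m + 1) * t)) = sin (2 * real (Suc m) * t) - sin (2 * real m * t)"
    using prod[of "(2 * real m + 1) * t"] by (simp add: algebra_simps)
  then show ?case using Suc by (simp add: distrib_left)
qed simp

text \<open>Multiplied by the sine of the basic angle \<open>t\<close>, the sum telescopes to
  \<open>sin (of_int i * pi) = 0\<close>; the divisibility condition is exactly what keeps
  \<open>sin t\<close> from vanishing.\<close>

lemma sum_two_cos_odd_eq_0:
  assumes "\<not> 2 ^ (n + 1) dvd i"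
  shows "(\<Sum>k<2 ^ n. two_cos n (i * (2 * int k + 1))) = 0"
proof -
  define t where "t = of_int i * (2 * pi / 2 ^ (n + 2))"
  have "two_cos n (i * (2 * int k + 1)) = 2 * cos ((2 * real k + 1) * t)" for k
    by (simp add: two_cos_def t_def mult_ac)
  then have "sin t * (\<Sum>k<2 ^ n. two_cos n (i * (2 * int k + 1))) = sin (2 * real (2 ^ n) * t)"
    by (simp only: sin_times_sum_cos_odd)
  also have "2 * real (2 ^ n) * t = of_int i * pi"
    by (simp add: t_def)
  also have "sin (of_int i * pi) = 0"
    by (auto simp: sin_zero_iff_int2)
  finally have "sin t * (\<Sum>k<2 ^ n. two_cos n (i * (2 * int k + 1))) = 0" .
  moreover have "sin t \<noteq> 0"
  proof
    assume "sin t = 0"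
    then obtain l where "t = of_int l * pi" by (auto simp: sin_zero_iff_int2)
    then have "of_int i = (of_int (2 ^ (n + 1) * l) :: real)"
      by (simp add: t_def field_simps)
    then have "i = 2 ^ (n + 1) * l" unfolding of_int_eq_iff .
    then show False using assms by simp
  qed
  ultimately show ?thesis by simp
qed

lemma sum_two_cos_odd_in_Rats: "(\<Sum>k<2 ^ n. two_cos n (i * (2 * int k + 1))) \<in> \<rat>"
proof (cases "2 ^ (n + 1) dvd i")
  case True
  then obtain l where l: "i = 2 ^ (n + 1) * l" by blast
  have half: "two_cos n (2 ^ (n + 1) * l) \<in> \<rat>" for l
  proof -
    have "of_int (2 ^ (n + 1) * l) * (2 * pi / 2 ^ (n + 2)) = of_int l * pi"
      by (simp add: field_simps)
    then have "two_cos n (2 ^ (n + 1) * l) = 2 * cos (of_int l * pi)"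
      unfolding two_cos_def by (simp only:)
    moreover have "sin (of_int l * pi) = 0" by (auto simp: sin_zero_iff_int2)
    then have "(cos (of_int l * pi))\<^sup>2 = 1"
      using sin_cos_squared_add[of "of_int l * pi"] by simp
    then have "cos (of_int l * pi) = 1 \<or> cos (of_int l * pi) = - 1"
      by (simp add: power2_eq_1_iff)
    ultimately show ?thesis by auto
  qed
  have "two_cos n (i * (2 * int k + 1)) \<in> \<rat>" for k
    using half[of "l * (2 * int k + 1)"] by (simp add: l mult.assoc)
  then show ?thesis by (intro Rats_sum) auto
next
  case False
  then show ?thesis by (simp add: sum_two_cos_odd_eq_0)
qed

text \<open>The additional cosine factor makes induction on \<open>p\<close> possible: a factor
  \<open>two_cos n (2 * int k + 1)\<close> is absorbed by moving \<open>i\<close> to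
  \<open>i + 1\<close> and \<open>i - 1\<close>. At \<open>i = 0\<close> that factor is 2, giving
  twice the trace.\<close>

lemma sum_rat_eval_two_cos_in_Rats:
  "(\<Sum>k<2 ^ n. rat_eval p (two_cos n (2 * int k + 1)) * two_cos n (i * (2 * int k + 1))) \<in> \<rat>"
proof (induction p arbitrary: i)
  case 0
  then show ?case by simp
next
  case (pCons a p)
  define f where "f i k = rat_eval p (two_cos n (2 * int k + 1)) * two_cos n (i * (2 * int k + 1))"
    for i :: int and k
  have "rat_eval (pCons a p) (two_cos n (2 * int k + 1)) * two_cos n (i * (2 * int k + 1))
      = of_rat a * two_cos n (i * (2 * int k + 1)) + (f (i + 1) k + f (i - 1) k)" for k
  proof -
    define j where "j = 2 * int k + 1"
    have "two_cos n j * two_cos n (i * j) = two_cos n ((i + 1) * j) + two_cos n ((i - 1) * j)"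
      using two_cos_mult[of n "i * j" j] by (simp add: algebra_simps)
    then have "rat_eval p (two_cos n j) * (two_cos n j * two_cos n (i * j)) = f (i + 1) k + f (i - 1) k"
      by (simp only: f_def j_def distrib_left)
    moreover have "rat_eval (pCons a p) (two_cos n j) * two_cos n (i * j)
      = of_rat a * two_cos n (i * j)
        + rat_eval p (two_cos n j) * (two_cos n j * two_cos n (i * j))"
      by (simp add: algebra_simps)
    ultimately show ?thesis by (simp only: j_def)
  qed
  then have "(\<Sum>k<2 ^ n. rat_eval (pCons a p) (two_cos n (2 * int k + 1)) * two_cos n (i * (2 * int k + 1)))
      = of_rat a * (\<Sum>k<2 ^ n. two_cos n (i * (2 * int k + 1)))
        + ((\<Sum>k<2 ^ n. f (i + 1) k) + (\<Sum>k<2 ^ n. f (i - 1) k))"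
    by (simp only: sum.distrib sum_distrib_left)
  moreover have "(\<Sum>k<2 ^ n. f i k) \<in> \<rat>" for i
    unfolding f_def by (rule pCons.IH)
  ultimately show ?case
    by (simp only: Rats_add Rats_mult Rats_of_rat sum_two_cos_odd_in_Rats)
qed

lemma rat_eval_of_int_poly: "rat_eval (map_poly of_int p) x = poly (map_poly of_int p) x"
proof -
  have "map_poly (of_rat :: rat \<Rightarrow> real) (map_poly of_int p) = map_poly of_int p"
    by (simp add: poly_eq_iff coeff_map_poly)
  then show ?thesis by (simp add: rat_eval_def)
qed

text \<open>Adding \<open>2 ^ (n + 1)\<close> to the index adds pi to the angle of
  \<open>X n\<close> and so negates it.\<close>

definition conj_map :: "nat \<Rightarrow> real \<Rightarrow> real" where
  "conj_map n = gal_map n (1 + 2 ^ (n + 1))"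

context
  fixes n :: nat
  assumes n: "n > 0"
begin

section \<open>Integrality of traces and attainment of the minimum\<close>

lemma Tr_in_Rats:
  assumes "x \<in> BB n" shows "Tr n x \<in> \<rat>"
proof -
  obtain p where p: "x = rat_eval p (X n)" using BB_cases[OF n assms] .
  have "2 * Tr n x = (\<Sum>k<2 ^ n. rat_eval p (two_cos n (2 * int k + 1)) * two_cos n (0 * (2 * int k + 1)))"
    by (simp add: Tr_eq_sum[OF n] p gal_map_rat_eval[OF n] sum_distrib_left mult.commute)
  then have "2 * Tr n x \<in> \<rat>" by (simp only: sum_rat_eval_two_cos_in_Rats)
  then have "2 * Tr n x / 2 \<in> \<rat>" by (intro Rats_divide) simp_all
  then show ?thesis by simp
qed

lemma algebraic_int_Gal:
  assumes "\<tau> \<in> Gal (BB n) \<rat>" "x \<in> BB n" "algebraic_int x"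
  shows "algebraic_int (\<tau> x)"
proof -
  obtain p where p: "poly (map_poly of_int p) x = 0" "lead_coeff p = (1::int)"
    using assms(3) by (auto simp: algebraic_int_altdef_ipoly)
  have "poly (map_poly of_int p) (\<tau> x) = \<tau> (poly (map_poly of_int p) x)"
    using Gal_rat_eval[OF n assms(1,2), of "map_poly of_int p"] by (simp add: rat_eval_of_int_poly)
  also have "\<dots> = 0" using p(1) assms(1) by (simp add: Gal_def)
  finally show ?thesis using p(2) by (auto simp: algebraic_int_altdef_ipoly)
qed

lemma Tr_in_Ints:
  assumes "x \<in> ring_of_integers (BB n)" shows "Tr n x \<in> \<int>"
proof (rule rational_algebraic_int_is_int)
  have x: "x \<in> BB n" "algebraic_int x" using assms by (auto simp: ring_of_integers_def)
  show "Tr n x \<in> \<rat>" by (rule Tr_in_Rats[OF x(1)])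
  show "algebraic_int (Tr n x)"
    unfolding rel_trace_def
  proof (rule algebraic_int_sum)
    fix \<tau> assume "\<tau> \<in> Gal (BB n) \<rat>"
    then show "algebraic_int (\<tau> x)" using x by (rule algebraic_int_Gal)
  qed
qed

lemma Tr_square_nonneg:
  assumes "x \<in> BB n" shows "Tr n (x\<^sup>2) \<ge> 0"
proof -
  have "\<tau> (x\<^sup>2) = (\<tau> x)\<^sup>2" if "\<tau> \<in> Gal (BB n) \<rat>" for \<tau>
    using that assms by (simp add: Gal_def power2_eq_square)
  then have "Tr n (x\<^sup>2) = (\<Sum>\<tau>\<in>Gal (BB n) \<rat>. (\<tau> x)\<^sup>2)"
    unfolding rel_trace_def by (intro sum.cong) auto
  then show ?thesis by (simp add: sum_nonneg)
qed

lemma Tr_square_minimum: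
  assumes E: "E \<subseteq> ring_of_integers (BB n)" and e: "e \<in> E" and B: "Tr n (e\<^sup>2) \<le> B"
  shows "\<exists>m\<in>{Tr n (e\<^sup>2) |e. e \<in> E}. (\<forall>t\<in>{Tr n (e\<^sup>2) |e. e \<in> E}. m \<le> t) \<and> m \<le> B"
proof -
  \<comment> \<open>Rounding changes nothing on \<open>E\<close>, where this trace is a nonnegative
    integer; it only gives access to the well-ordering of the naturals.\<close>
  define N where "N x = nat \<lfloor>Tr n (x\<^sup>2)\<rfloor>" for x
  have N: "Tr n (x\<^sup>2) = real (N x)" if "x \<in> E" for x
  proof -
    have x: "x \<in> BB n" "algebraic_int x" using that E by (auto simp: ring_of_integers_def)
    then have "x\<^sup>2 \<in> ring_of_integers (BB n)"
      by (auto simp: ring_of_integers_def power2_eq_square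
          intro!: algebraic_int_plus_times real_subfield_closed[OF real_subfield_BB])
    then have "Tr n (x\<^sup>2) \<in> \<int>" by (rule Tr_in_Ints)
    then obtain z where "Tr n (x\<^sup>2) = of_int z" by (auto elim: Ints_cases)
    then show ?thesis using Tr_square_nonneg[OF x(1)] by (simp add: N_def)
  qed
  obtain d where d: "d \<in> E" "\<And>x. x \<in> E \<Longrightarrow> N d \<le> N x"
    using ex_has_least_nat[of "\<lambda>x. x \<in> E" e N] e by blast
  have "Tr n (d\<^sup>2) \<le> Tr n (x\<^sup>2)" if "x \<in> E" for x
    using d that by (simp add: N)
  then show ?thesis using d(1) e B by (intro bexI[of _ "Tr n (d\<^sup>2)"]) (auto intro: order_trans)
qed

text \<open>It reduces fixing all of \<open>BB (n - 1)\<close> to fixing its generator, because that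
  layer is the least subfield containing \<open>X (n - 1)\<close>.\<close>

lemma subfield_fixed_points:
  assumes "\<tau> \<in> Gal (BB n) \<rat>" shows "real_subfield {x \<in> BB n. \<tau> x = x}"
proof -
  note closed = real_subfield_closed[OF real_subfield_BB]
  have hom: "\<tau> (x + y) = \<tau> x + \<tau> y" "\<tau> (x * y) = \<tau> x * \<tau> y" if "x \<in> BB n" "y \<in> BB n" for x y
    using assms that by (auto simp: Gal_def)
  have rat: "\<tau> x = x" if "x \<in> \<rat>" for x using assms that by (simp add: Gal_def)
  have diff: "\<tau> (x - y) = \<tau> x - \<tau> y" if "x \<in> BB n" "y \<in> BB n" for x y
    using hom(1)[of "x - y" y] that closed(3) by simp
  have inv: "\<tau> (inverse x) = inverse x" if "x \<in> BB n" "\<tau> x = x" for x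
  proof (cases "x = 0")
    case False
    then have "\<tau> (inverse x) * x = 1"
      using hom(2)[of "inverse x" x] that closed(5) rat[of 1] by simp
    then show ?thesis using False by (simp add: field_simps)
  qed (use rat in simp)
  show ?thesis unfolding real_subfield_def
    using rat hom(2) diff inv closed by auto
qed

lemma two_cos_mult_conj: "two_cos n (i * (1 + 2 ^ (n + 1))) = (if even i then two_cos n i else - two_cos n i)"
proof -
  have "two_cos n (i * (1 + 2 ^ (n + 1))) = two_cos n (if even i then i else i + 2 ^ (n + 1))"
  proof (cases "even i")
    case True
    then obtain l where "i = 2 * l" by blast
    then have "i * (1 + 2 ^ (n + 1)) = i + l * 2 ^ (n + 2)" by (simp add: algebra_simps)
    then show ?thesis using True by (simp only: two_cos_add_period if_True)
  next
    case False
    then obtain l where "i = 2 * l + 1" by (elim oddE)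
    then have "i * (1 + 2 ^ (n + 1)) = (i + 2 ^ (n + 1)) + l * 2 ^ (n + 2)" by (simp add: algebra_simps)
    then show ?thesis using False by (simp only: two_cos_add_period if_False)
  qed
  then show ?thesis by (simp only: two_cos_add_half if_distrib[of "two_cos n"])
qed

lemma conj_map_two_cos: "conj_map n (two_cos n i) = (if even i then two_cos n i else - two_cos n i)"
  unfolding conj_map_def two_cos_mult_conj[symmetric] by (rule gal_map_two_cos[OF n]) simp

lemma conj_map_X: "conj_map n (X n) = - X n"
  using conj_map_two_cos[of 1] by simp

lemma conj_map_in_Gal: "conj_map n \<in> Gal (BB n) \<rat>"
  unfolding conj_map_def by (rule gal_map_in_Gal[OF n]) simp

text \<open>Since \<open>X (n - 1)\<close> is the square of \<open>X n\<close> minus 2, fixing it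
  leaves only the choice of sign for \<open>X n\<close>.\<close>

lemma Gal_over_previous_layer: "Gal (BB n) (BB (n - 1)) = {gal_map n 1, conj_map n}"
proof
  have prev: "X (n - 1) = (X n)\<^sup>2 - 2" using X_eq[of "n - 1"] n by simp
  note prev_simp = prev[unfolded One_nat_def]
  show "Gal (BB n) (BB (n - 1)) \<subseteq> {gal_map n 1, conj_map n}"
  proof
    fix \<tau> assume \<tau>: "\<tau> \<in> Gal (BB n) (BB (n - 1))"
    then have \<tau>Q: "\<tau> \<in> Gal (BB n) \<rat>"
      using Rats_subset_real_subfield[OF real_subfield_BB, of "n - 1"] by (auto simp: Gal_def)
    have "\<tau> (rat_eval [:-2, 0, 1:] (X n)) = rat_eval [:-2, 0, 1:] (\<tau> (X n))"
      by (rule Gal_rat_eval[OF n \<tau>Q X_in_BB])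
    then have "\<tau> (X (n - 1)) = (\<tau> (X n))\<^sup>2 - 2"
      by (simp add: prev_simp power2_eq_square of_rat_minus)
    moreover have "\<tau> (X (n - 1)) = X (n - 1)"
      using \<tau> X_in_BB[of "n - 1"] by (simp add: Gal_def)
    ultimately have "(\<tau> (X n))\<^sup>2 = (X n)\<^sup>2" by (simp add: prev_simp)
    then have "\<tau> (X n) = X n \<or> \<tau> (X n) = - X n" by (simp add: power2_eq_iff)
    then have "\<tau> (X n) = gal_map n 1 (X n) \<or> \<tau> (X n) = conj_map n (X n)"
      using gal_map_X[OF n, of 1] conj_map_X by simp
    then show "\<tau> \<in> {gal_map n 1, conj_map n}"
      using Gal_eqI[OF n \<tau>Q gal_map_in_Gal[OF n, of 1]] Gal_eqI[OF n \<tau>Q conj_map_in_Gal] by auto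
  qed
  show "{gal_map n 1, conj_map n} \<subseteq> Gal (BB n) (BB (n - 1))"
  proof
    fix \<tau> assume "\<tau> \<in> {gal_map n 1, conj_map n}"
    then have \<tau>: "\<tau> \<in> Gal (BB n) \<rat>" and X: "\<tau> (X n) = X n \<or> \<tau> (X n) = - X n"
      using gal_map_in_Gal[OF n, of 1] conj_map_in_Gal conj_map_X gal_map_X[OF n, of 1] by auto
    have "\<tau> (rat_eval [:-2, 0, 1:] (X n)) = rat_eval [:-2, 0, 1:] (\<tau> (X n))"
      by (rule Gal_rat_eval[OF n \<tau> X_in_BB])
    then have "\<tau> (X (n - 1)) = X (n - 1)"
      using X by (auto simp: prev_simp power2_eq_square of_rat_minus)
    moreover have "X (n - 1) \<in> BB n"
      unfolding prev using real_subfield_closed[OF real_subfield_BB] Rats_subset_real_subfield[OF real_subfield_BB]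
        X_in_BB by (metis Rats_number_of power2_eq_square subsetD)
    ultimately have "BB (n - 1) \<subseteq> {x \<in> BB n. \<tau> x = x}"
      unfolding BB_def[of "n - 1"] using subfield_fixed_points[OF \<tau>] by (intro hull_minimal) auto
    then show "\<tau> \<in> Gal (BB n) (BB (n - 1))" using \<tau> by (auto simp: Gal_def)
  qed
qed

lemma rel_norm_eq:
  assumes "x \<in> BB n" shows "rel_norm (BB n) (BB (n - 1)) x = x * conj_map n x"
proof -
  \<comment> \<open>The norm is a product over a set, so the two automorphisms must be seen to
    differ for both factors to occur.\<close>
  have "gal_map n 1 (X n) \<noteq> conj_map n (X n)"
    using conj_map_X gal_map_X[OF n, of 1] X_pos[OF n] by simp
  then have "gal_map n 1 \<noteq> conj_map n" by metis
  then show ?thesis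
    unfolding rel_norm_def Gal_over_previous_layer using gal_map_id[OF n _ assms, of 1] by simp
qed

text \<open>The conjugate of an algebraic integer is integral, so relative norm 1 already exhibits
  the inverse that a unit needs.\<close>

lemma RE_plusI:
  assumes "x \<in> BB n" "algebraic_int x" "x * conj_map n x = 1"
  shows "x \<in> RE_plus n"
proof -
  have "conj_map n x \<in> ring_of_integers (BB n)"
    using assms algebraic_int_Gal[OF conj_map_in_Gal] Bij_imp_funcset conj_map_in_Gal
    by (auto simp: ring_of_integers_def Gal_def)
  then show ?thesis
    using assms rel_norm_eq[OF assms(1)]
    unfolding RE_plus_def integer_units_def ring_of_integers_def by auto
qed

section \<open>The Galois group as a cyclic group, and the identification of
  \<open>sigma n\<close>\<close>

lemma BijGroup_mult_gal_map:
  assumes "odd i" "odd j"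
  shows "gal_map n i \<otimes>\<^bsub>BijGroup (BB n)\<^esub> gal_map n j = gal_map n (i * j)"
proof -
  have Bij: "gal_map n k \<in> Bij (BB n)" if "odd k" for k
    using gal_map_in_Gal[OF n that] by (simp add: Gal_def)
  have "compose (BB n) (gal_map n i) (gal_map n j) = gal_map n (i * j)"
  proof (rule extensionalityI[of _ "BB n"])
    show "gal_map n (i * j) \<in> extensional (BB n)" by (simp add: gal_map_def)
    fix x assume "x \<in> BB n"
    then show "compose (BB n) (gal_map n i) (gal_map n j) x = gal_map n (i * j) x"
      using gal_map_comp[OF n assms] by (simp add: compose_def)
  qed simp
  then show ?thesis using Bij assms by (simp add: BijGroup_def)
qed

lemma subgroup_Gal: "subgroup (Gal (BB n) \<rat>) (BijGroup (BB n))"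
proof -
  interpret group "BijGroup (BB n)" by (rule group_BijGroup)
  have carrier: "Gal (BB n) \<rat> \<subseteq> carrier (BijGroup (BB n))"
    by (auto simp: Gal_def BijGroup_def)
  show ?thesis
  proof (rule subgroupI[OF carrier])
    show "Gal (BB n) \<rat> \<noteq> {}" using gal_map_in_Gal[OF n, of 1] by auto
  next
    fix \<tau> assume "\<tau> \<in> Gal (BB n) \<rat>"
    then obtain j where j: "odd j" "\<tau> = gal_map n j" by (rule Gal_cases[OF n])
    obtain i where i: "odd i" "two_cos n (i * j) = X n" using gal_map_inverse[OF n j(1)] .
    have "gal_map n (i * j) = (\<lambda>x\<in>BB n. x)"
    proof (rule extensionalityI[of _ "BB n"])
      show "gal_map n (i * j) \<in> extensional (BB n)" by (simp add: gal_map_def)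
    qed (simp_all add: gal_map_id[OF n i(2)])
    then have "gal_map n i \<otimes>\<^bsub>BijGroup (BB n)\<^esub> gal_map n j = \<one>\<^bsub>BijGroup (BB n)\<^esub>"
      using i(1) j(1) by (simp add: BijGroup_mult_gal_map) (simp add: BijGroup_def)
    then have "inv\<^bsub>BijGroup (BB n)\<^esub> \<tau> = gal_map n i"
      unfolding j(2) using carrier gal_map_in_Gal[OF n] i(1) j(1) by (intro inv_equality) auto
    then show "inv\<^bsub>BijGroup (BB n)\<^esub> \<tau> \<in> Gal (BB n) \<rat>" using gal_map_in_Gal[OF n i(1)] by simp
  next
    fix \<tau> \<rho> assume "\<tau> \<in> Gal (BB n) \<rat>" "\<rho> \<in> Gal (BB n) \<rat>"
    then obtain i j where "odd i" "\<tau> = gal_map n i" "odd j" "\<rho> = gal_map n j"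
      using Gal_cases[OF n] by metis
    then show "\<tau> \<otimes>\<^bsub>BijGroup (BB n)\<^esub> \<rho> \<in> Gal (BB n) \<rat>"
      using gal_map_in_Gal[OF n, of "i * j"] by (simp add: BijGroup_mult_gal_map)
  qed
qed

text \<open>Uniqueness in the definite description comes from the value at \<open>X n\<close> alone.
  The generation clause reduces to powers of 3 reaching every conjugate index.\<close>

lemma sigma_eqI:
  assumes powers: "\<And>j. odd j \<Longrightarrow> \<exists>k. two_cos n j = two_cos n (3 ^ k)"
  shows "sigma n = gal_map n 3"
  unfolding sigma_def
proof (rule the_equality)
  interpret group "BijGroup (BB n)" by (rule group_BijGroup)
  have in_Gal: "gal_map n 3 \<in> Gal (BB n) \<rat>" by (rule gal_map_in_Gal[OF n]) simp
  have "gal_map n (3 ^ k) \<in> generate (BijGroup (BB n)) {gal_map n 3}" for k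
  proof (induction k)
    case 0
    have "gal_map n 1 = (\<lambda>x\<in>BB n. x)"
    proof (rule extensionalityI[of _ "BB n"])
      show "gal_map n 1 \<in> extensional (BB n)" by (simp add: gal_map_def)
    qed (simp_all add: gal_map_id[OF n])
    also have "\<dots> = \<one>\<^bsub>BijGroup (BB n)\<^esub>" by (simp add: BijGroup_def)
    finally show ?case by (simp add: generate.one)
  next
    case (Suc k)
    have "gal_map n 3 \<otimes>\<^bsub>BijGroup (BB n)\<^esub> gal_map n (3 ^ k)
        \<in> generate (BijGroup (BB n)) {gal_map n 3}"
      by (intro generate.eng generate.incl Suc) simp
    then show ?case by (simp add: BijGroup_mult_gal_map)
  qed
  then have "\<tau> \<in> generate (BijGroup (BB n)) {gal_map n 3}" if "\<tau> \<in> Gal (BB n) \<rat>" for \<tau>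
    using Gal_cases[OF n that] powers gal_map_cong by metis
  moreover have "generate (BijGroup (BB n)) {gal_map n 3} \<subseteq> Gal (BB n) \<rat>"
    using in_Gal by (intro generate_subgroup_incl subgroup_Gal) simp
  ultimately have "generate (BijGroup (BB n)) {gal_map n 3} = Gal (BB n) \<rat>" by blast
  moreover have X3: "gal_map n 3 (X n) = 2 * cos (3 * (2 * pi / 2 ^ (n + 2)))"
    by (simp add: gal_map_X[OF n] two_cos_def)
  ultimately show "gal_map n 3 \<in> Gal (BB n) \<rat> \<and>
    generate (BijGroup (BB n)) {gal_map n 3} = Gal (BB n) \<rat> \<and>
    gal_map n 3 (X n) = 2 * cos (3 * (2 * pi / 2 ^ (n + 2)))"
    using in_Gal by blast
  show "\<tau> = gal_map n 3" if "\<tau> \<in> Gal (BB n) \<rat> \<and>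
    generate (BijGroup (BB n)) {\<tau>} = Gal (BB n) \<rat> \<and>
    \<tau> (X n) = 2 * cos (3 * (2 * pi / 2 ^ (n + 2)))" for \<tau>
    using Gal_eqI[OF n _ in_Gal] that X3 by simp
qed

end

text \<open>The exact power of 2 in \<open>3 ^ 2 ^ n - 1\<close>: from \<open>9 = 1 + 8\<close> on,
  each squaring contributes exactly one more factor. Oddness of \<open>d\<close> is what the lifting
  of congruences uses.\<close>

lemma three_power_two_power:
  assumes "n > 0"
  shows "\<exists>d. odd d \<and> (3::int) ^ 2 ^ n = 1 + 2 ^ (n + 2) * d"
  using assms
proof (induction n rule: nat_induct_non_zero)
  case 1
  then show ?case by (intro exI[of _ 1]) simp
next
  case (Suc n)
  then obtain d where d: "odd d" "(3::int) ^ 2 ^ n = 1 + 2 ^ (n + 2) * d" by blast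
  have "(3::int) ^ 2 ^ Suc n = (3 ^ 2 ^ n)\<^sup>2" by (simp add: power_mult[symmetric] mult.commute)
  also have "\<dots> = 1 + 2 ^ (Suc n + 2) * (d + 2 ^ (n + 1) * d\<^sup>2)"
    unfolding d(2) by (simp add: power2_eq_square algebra_simps)
  finally show ?case using d(1) by (intro exI[of _ "d + 2 ^ (n + 1) * d\<^sup>2"]) simp
qed

text \<open>Congruences are lifted one binary digit at a time: if the digit is wrong, the factor
  \<open>3 ^ 2 ^ n\<close> flips it. The start is modulo 8, where the odd residues are 1, 3 and
  their negatives.\<close>

lemma three_powers_mod_two_power:
  assumes "n > 0" "odd j"
  shows "\<exists>k c. 3 ^ k = j + c * 2 ^ (n + 2) \<or> 3 ^ k = - j + c * (2::int) ^ (n + 2)"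
  using assms
proof (induction n rule: nat_induct_non_zero)
  case 1
  then consider c where "j = 8 * c + 1" | c where "j = 8 * c + 3" | c where "j = 8 * c - 3"
    | c where "j = 8 * c - 1"
  proof -
    have "j = 8 * (j div 8) + j mod 8" by simp
    moreover have "j mod 8 = 1 \<or> j mod 8 = 3 \<or> j mod 8 = 5 \<or> j mod 8 = 7"
      using 1 by presburger
    ultimately show ?thesis
      using that(1)[of "j div 8"] that(2)[of "j div 8"] that(3)[of "j div 8 + 1"] that(4)[of "j div 8 + 1"]
      by (elim disjE) simp_all
  qed
  then show ?case
  proof cases
    case (1 c)
    then show ?thesis by (intro exI[of _ 0] exI[of _ "- c"]) simp
  next
    case (2 c)
    then show ?thesis by (intro exI[of _ 1] exI[of _ "- c"]) simp
  next
    case (3 c)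
    then show ?thesis by (intro exI[of _ 1] exI[of _ c]) simp
  next
    case (4 c)
    then show ?thesis by (intro exI[of _ 0] exI[of _ c]) simp
  qed
next
  case (Suc n)
  have lift: "\<exists>l e. 3 ^ l = s + e * (2::int) ^ (Suc n + 2)"
    if s: "odd s" and k: "3 ^ k = s + c * 2 ^ (n + 2)" for s c :: int and k
  proof (cases "even c")
    case True
    then obtain e where "c = 2 * e" by blast
    then show ?thesis using k by (intro exI[of _ k] exI[of _ e]) simp
  next
    case False
    obtain d where d: "odd d" "(3::int) ^ 2 ^ n = 1 + 2 ^ (n + 2) * d"
      using three_power_two_power[OF Suc.hyps] by blast
    \<comment> \<open>Here \<open>c\<close>, \<open>s\<close> and \<open>d\<close> are odd, so the
      first two terms cancel modulo 2 and the last is even.\<close>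
    have "even (c + s * d + c * d * 2 ^ (n + 2))" using False s d(1) by simp
    then obtain e where e: "c + s * d + c * d * 2 ^ (n + 2) = 2 * e" by blast
    have "3 ^ (k + 2 ^ n) = s + (c + s * d + c * d * 2 ^ (n + 2)) * 2 ^ (n + 2)"
      unfolding power_add[of _ k] k d(2) by (simp add: algebra_simps)
    also have "\<dots> = s + e * 2 ^ (Suc n + 2)" unfolding e by simp
    finally show ?thesis by blast
  qed
  obtain k c where "3 ^ k = j + c * 2 ^ (n + 2) \<or> 3 ^ k = - j + c * 2 ^ (n + 2)"
    using Suc.IH[OF Suc.prems] by blast
  then show ?case using lift[of j k c] lift[of "- j" k c] Suc.prems by auto
qed

lemma sigma_eq:
  assumes "n > 0" shows "sigma n = gal_map n 3"
proof (rule sigma_eqI[OF assms])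
  fix j :: int assume "odd j"
  then obtain k c where "3 ^ k = j + c * 2 ^ (n + 2) \<or> 3 ^ k = - j + c * 2 ^ (n + 2)"
    using three_powers_mod_two_power[OF assms] by blast
  then have "two_cos n (3 ^ k) = two_cos n j"
    by (elim disjE) (simp_all only: two_cos_add_period two_cos_minus)
  then show "\<exists>k. two_cos n j = two_cos n (3 ^ k)" by metis
qed

section \<open>The units\<close>

text \<open>The common shape of the units, with signs \<open>s\<close> on the support
  \<open>I\<close>. The index \<open>j\<close> selects the conjugate, so one formula serves the
  trace and the norm.\<close>

definition cos_comb :: "nat \<Rightarrow> int \<Rightarrow> (nat \<Rightarrow> int) \<Rightarrow> nat set \<Rightarrow> int \<Rightarrow> real" where
  "cos_comb n a s I j = of_int a + 2 * (\<Sum>i\<in>I. of_int (s i) * two_cos n (int i * j))"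

lemma rat_eval_sum [simp]: "rat_eval (\<Sum>i\<in>I. f i) x = (\<Sum>i\<in>I. rat_eval (f i) x)"
  by (induction I rule: infinite_finite_induct) simp_all

lemma cos_comb_eq_rat_eval:
  "cos_comb n a s I j = rat_eval ([:of_int a:] +
    Polynomial.smult 2 (\<Sum>i\<in>I. Polynomial.smult (of_int (s i)) (chebyshev i))) (two_cos n j)"
  by (simp add: cos_comb_def rat_eval_chebyshev)

lemma cos_comb_in_BB: "cos_comb n a s I j \<in> BB n"
  unfolding cos_comb_eq_rat_eval by (intro rat_eval_in_BB two_cos_in_BB)

lemma gal_map_cos_comb:
  assumes "n > 0" "odd j"
  shows "gal_map n j (cos_comb n a s I 1) = cos_comb n a s I j"
  unfolding cos_comb_eq_rat_eval two_cos_1 by (rule gal_map_rat_eval[OF assms])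

lemma algebraic_int_two_cos: "algebraic_int (two_cos n (int k))"
proof (induction k rule: chebyshev.induct)
  case (3 k)
  have "two_cos n (int (Suc (Suc k))) = two_cos n (int (Suc k)) * X n - two_cos n (int k)"
    using two_cos_mult[of n "int (Suc k)" 1] by simp
  then show ?case
    using 3 by (simp only: algebraic_int_diff algebraic_int_plus_times(2) algebraic_int_X)
qed simp_all

lemma algebraic_int_cos_comb: "algebraic_int (cos_comb n a s I 1)"
  unfolding cos_comb_def mult_1_right
  by (intro algebraic_int_plus_times algebraic_int_sum algebraic_int_two_cos) simp_all

text \<open>Product-to-sum leaves indices \<open>i + l\<close> and \<open>i - l\<close>; within the
  given range only \<open>i - l = 0\<close> is a multiple of \<open>2 ^ (n + 1)\<close>, and there
  each summand is 2.\<close>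

lemma sum_two_cos_mult:
  assumes "0 < i" "i < 2 ^ n" "0 < l" "l < 2 ^ n"
  shows "(\<Sum>k<2 ^ n. two_cos n (int i * (2 * int k + 1)) * two_cos n (int l * (2 * int k + 1)))
    = (if i = l then 2 * 2 ^ n else 0)"
proof -
  have "(\<Sum>k<2 ^ n. two_cos n (int i * (2 * int k + 1)) * two_cos n (int l * (2 * int k + 1)))
    = (\<Sum>k<2 ^ n. two_cos n ((int i + int l) * (2 * int k + 1)))
      + (\<Sum>k<2 ^ n. two_cos n ((int i - int l) * (2 * int k + 1)))"
    by (simp only: two_cos_mult sum.distrib distrib_right left_diff_distrib)
  also have "(\<Sum>k<2 ^ n. two_cos n ((int i + int l) * (2 * int k + 1))) = 0"
  proof (rule sum_two_cos_odd_eq_0)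
    have "int i < 2 ^ n" "int l < 2 ^ n" using assms by simp_all
    then have "int i + int l < 2 ^ (n + 1)" unfolding power_add power_one_right by linarith
    then show "\<not> 2 ^ (n + 1) dvd int i + int l"
      using assms by (intro zdvd_not_zless) auto
  qed
  also have "(\<Sum>k<2 ^ n. two_cos n ((int i - int l) * (2 * int k + 1))) = (if i = l then 2 * 2 ^ n else 0)"
  proof (cases "i = l")
    case False
    have "\<not> 2 ^ (n + 1) dvd int i - int l"
    proof
      assume "2 ^ (n + 1) dvd int i - int l"
      then have "2 ^ (n + 1) \<le> \<bar>int i - int l\<bar>" using False dvd_imp_le_int[of "int i - int l" "2 ^ (n + 1)"] by simp
      moreover have "int i < 2 ^ n" "int l < 2 ^ n" using assms by simp_all
      ultimately show False unfolding power_add power_one_right by linarith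
    qed
    then show ?thesis using False by (subst sum_two_cos_odd_eq_0) simp_all
  qed simp
  finally show ?thesis by simp
qed

lemma sum_two_cos_eq_0:
  assumes "0 < i" "i < 2 ^ n"
  shows "(\<Sum>k<2 ^ n. two_cos n (int i * (2 * int k + 1))) = 0"
proof (rule sum_two_cos_odd_eq_0)
  have "int i < 2 ^ n" using assms by simp
  then have "int i < 2 ^ (n + 1)" unfolding power_add power_one_right by linarith
  then show "\<not> 2 ^ (n + 1) dvd int i" using assms by (intro zdvd_not_zless) auto
qed

text \<open>Orthogonality removes all mixed terms, including those with the constant
  \<open>a\<close>. A cosine with coefficient 2 or -2 contributes
  \<open>4 * (2 * 2 ^ n)\<close>.\<close>

lemma Tr_cos_comb_squared:
  assumes n: "n > 0" and I: "I \<subseteq> {0<..<2 ^ n}" and s: "\<And>i. i \<in> I \<Longrightarrow> (s i)\<^sup>2 = 1"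
  shows "Tr n ((cos_comb n a s I 1)\<^sup>2) = 2 ^ n * (of_int (a\<^sup>2) + 8 * real (card I))"
proof -
  define t where "t i k = two_cos n (int i * (2 * int k + 1))" for i k
  define S where "S k = (\<Sum>i\<in>I. of_int (s i) * t i k)" for k
  have fin: "finite I" using I finite_subset by blast
  have "gal_map n (2 * int k + 1) ((cos_comb n a s I 1)\<^sup>2) = (of_int a + 2 * S k)\<^sup>2" for k
  proof -
    have "gal_map n (2 * int k + 1) \<in> Gal (BB n) \<rat>" by (intro gal_map_in_Gal n) simp
    then have "gal_map n (2 * int k + 1) ((cos_comb n a s I 1)\<^sup>2)
        = (gal_map n (2 * int k + 1) (cos_comb n a s I 1))\<^sup>2"
      using cos_comb_in_BB by (simp add: Gal_def power2_eq_square)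
    also have "\<dots> = (of_int a + 2 * S k)\<^sup>2"
      by (subst gal_map_cos_comb[OF n]) (simp_all add: cos_comb_def S_def t_def)
    finally show ?thesis .
  qed
  then have "Tr n ((cos_comb n a s I 1)\<^sup>2) = (\<Sum>k<2 ^ n. (of_int a + 2 * S k)\<^sup>2)"
    by (simp add: Tr_eq_sum[OF n])
  also have "\<dots> = 2 ^ n * (of_int a)\<^sup>2 + 4 * of_int a * (\<Sum>k<2 ^ n. S k) + 4 * (\<Sum>k<2 ^ n. (S k)\<^sup>2)"
    by (simp add: power2_sum power_mult_distrib sum.distrib sum_distrib_left mult_ac)
  also have "(\<Sum>k<2 ^ n. S k) = (\<Sum>i\<in>I. of_int (s i) * (\<Sum>k<2 ^ n. t i k))"
    unfolding S_def by (subst sum.swap) (simp add: sum_distrib_left)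
  also have "\<dots> = 0"
    using I by (intro sum.neutral ballI) (auto simp: t_def sum_two_cos_eq_0)
  also have "(\<Sum>k<2 ^ n. (S k)\<^sup>2)
      = (\<Sum>i\<in>I. \<Sum>l\<in>I. of_int (s i * s l) * (\<Sum>k<2 ^ n. t i k * t l k))"
  proof -
    have "(S k)\<^sup>2 = (\<Sum>i\<in>I. \<Sum>l\<in>I. of_int (s i * s l) * (t i k * t l k))" for k
      unfolding S_def power2_eq_square sum_product by (simp add: mult_ac)
    then have "(\<Sum>k<2 ^ n. (S k)\<^sup>2)
        = (\<Sum>k<2 ^ n. \<Sum>i\<in>I. \<Sum>l\<in>I. of_int (s i * s l) * (t i k * t l k))" by (simp only:)
    also have "\<dots> = (\<Sum>i\<in>I. \<Sum>k<2 ^ n. \<Sum>l\<in>I. of_int (s i * s l) * (t i k * t l k))"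
      by (rule sum.swap)
    also have "\<dots> = (\<Sum>i\<in>I. \<Sum>l\<in>I. \<Sum>k<2 ^ n. of_int (s i * s l) * (t i k * t l k))"
      by (intro sum.cong refl sum.swap)
    finally show ?thesis by (simp only: sum_distrib_left)
  qed
  also have "\<dots> = (\<Sum>i\<in>I. \<Sum>l\<in>I. if i = l then 2 * 2 ^ n else 0)"
  proof (intro sum.cong refl)
    fix i l assume il: "i \<in> I" "l \<in> I"
    then have "(\<Sum>k<2 ^ n. t i k * t l k) = (if i = l then 2 * 2 ^ n else 0)"
      unfolding t_def using I by (intro sum_two_cos_mult) auto
    moreover have "real_of_int (s i * s i) = 1" using s[OF il(1)] by (simp add: power2_eq_square)
    ultimately show "of_int (s i * s l) * (\<Sum>k<2 ^ n. t i k * t l k) = (if i = l then 2 * 2 ^ n else 0)"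
      by (cases "i = l") (simp_all only: if_True if_False mult_1 mult_zero_right refl)
  qed
  also have "\<dots> = real (card I) * (2 * 2 ^ n)"
    using fin by simp
  finally show ?thesis by (simp add: algebra_simps)
qed

lemma Tr_square_of_pm1:
  assumes "n > 0" "x \<in> {1, -1}" shows "Tr n (x\<^sup>2) = 2 ^ n"
proof -
  have "Tr n ((cos_comb n 1 (\<lambda>_. 1) {} 1)\<^sup>2) = 2 ^ n"
    by (subst Tr_cos_comb_squared[OF assms(1)]) simp_all
  then show ?thesis using assms(2) by (auto simp: cos_comb_def)
qed

text \<open>Only the relative norm needs separate arguments for the different units. The condition
  on \<open>C\<close> also covers a constant term other than 1. Positivity of \<open>C\<close>
  excludes 1 and -1, whose squares have trace only \<open>2 ^ n\<close>.\<close>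

lemma cos_comb_unit:
  assumes n: "n > 0" and I: "I \<subseteq> {0<..<2 ^ n}" and s: "\<And>i. i \<in> I \<Longrightarrow> (s i)\<^sup>2 = 1"
    and x: "x = cos_comb n a s I 1" and norm: "x * conj_map n x = 1"
    and C: "a\<^sup>2 + 8 * int (card I) = 1 + 8 * C" "C > 0"
  shows "x \<in> RE_plus n - {1, -1} \<and>
       Tr n (x\<^sup>2) = 2 ^ n * (1 + 8 * real_of_int C) \<and>
       (\<exists>m \<in> {Tr n (e\<^sup>2) |e. e \<in> RE_plus n - {1, -1}}.
          (\<forall>t \<in> {Tr n (e\<^sup>2) |e. e \<in> RE_plus n - {1, -1}}. m \<le> t) \<and>
          m \<le> 2 ^ n * (1 + 8 * real_of_int C))"
proof -
  have "real_of_int (a\<^sup>2 + 8 * int (card I)) = real_of_int (1 + 8 * C)" using C(1) by (simp only:)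
  then have "of_int (a\<^sup>2) + 8 * real (card I) = 1 + 8 * real_of_int C" by simp
  then have Tr: "Tr n (x\<^sup>2) = 2 ^ n * (1 + 8 * real_of_int C)"
    using Tr_cos_comb_squared[OF n I s, where a = a] by (simp only: x)
  have "x \<notin> {1, -1}"
  proof
    assume "x \<in> {1, -1}"
    then have "2 ^ n * (1 + 8 * real_of_int C) = 2 ^ n * 1"
      using Tr_square_of_pm1[OF n] Tr by simp
    then have "1 + 8 * real_of_int C = 1" by (subst (asm) mult_left_cancel) simp_all
    then show False using C(2) by simp
  qed
  moreover have "x \<in> RE_plus n"
    using norm by (intro RE_plusI[OF n]) (simp_all only: x cos_comb_in_BB algebraic_int_cos_comb)
  ultimately have x_in: "x \<in> RE_plus n - {1, -1}" by blast
  moreover have "RE_plus n - {1, -1} \<subseteq> ring_of_integers (BB n)"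
    by (auto simp: RE_plus_def integer_units_def)
  ultimately show ?thesis
    using Tr Tr_square_minimum[OF n, of "RE_plus n - {1, -1}" x] by simp
qed

section \<open>The even units as tangent quotients\<close>

lemma sin_half_times_sum_cos:
  fixes x :: real
  assumes "0 < A" "A \<le> Suc B"
  shows "sin (x / 2) * (\<Sum>i\<in>{A..B}. 2 * cos (real i * x))
    = sin ((real B + 1 / 2) * x) - sin ((real A - 1 / 2) * x)"
proof -
  have prod: "2 * (sin (x / 2) * cos y) = sin (y + x / 2) - sin (y - x / 2)" for y
    by (simp add: sin_add sin_diff)
  have "sin (x / 2) * (2 * cos (real i * x)) = sin ((real (Suc i) - 1 / 2) * x) - sin ((real i - 1 / 2) * x)" for i
    using prod[of "real i * x"] by (simp add: algebra_simps)
  then have "sin (x / 2) * (\<Sum>i\<in>{A..B}. 2 * cos (real i * x))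
      = (\<Sum>i\<in>{A..B}. sin ((real (Suc i) - 1 / 2) * x) - sin ((real i - 1 / 2) * x))"
    by (simp only: sum_distrib_left)
  also have "\<dots> = sin ((real (Suc B) - 1 / 2) * x) - sin ((real A - 1 / 2) * x)"
    by (rule sum_Suc_diff[OF assms(2)])
  also have "real (Suc B) - 1 / 2 = real B + 1 / 2" by simp
  finally show ?thesis .
qed

text \<open>Times \<open>cos t\<close>, the difference \<open>2 * (sin (3 * t) - sin t)\<close>
  collapses to \<open>sin (4 * t)\<close>, and subtracting this from
  \<open>sin (5 * t) * cos t\<close> leaves \<open>sin t * cos (5 * t)\<close>. The cleared form
  avoids denominators.\<close>

lemma tan_quotient:
  fixes t v :: real
  assumes "v * sin (5 * t) = sin (5 * t) - 2 * (sin (3 * t) - sin t)"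
  shows "v * (cos t * sin (5 * t)) = sin t * cos (5 * t)"
proof -
  have "sin (5 * t - t) = sin (5 * t) * cos t - cos (5 * t) * sin t" by (rule sin_diff)
  moreover have "sin (3 * t + t) = sin (3 * t) * cos t + cos (3 * t) * sin t" by (rule sin_add)
  moreover have "sin (3 * t - t) = sin (3 * t) * cos t - cos (3 * t) * sin t" by (rule sin_diff)
  moreover have "sin (t + t) = sin t * cos t + cos t * sin t" by (rule sin_add)
  ultimately have "(sin (5 * t) - 2 * (sin (3 * t) - sin t)) * cos t = sin t * cos (5 * t)"
    by (simp add: algebra_simps)
  then have "v * sin (5 * t) * cos t = sin t * cos (5 * t)" unfolding assms .
  then show ?thesis by (simp only: mult_ac)
qed

lemma sin_odd_pi_minus:
  assumes "odd j" shows "sin (of_int j * pi - x) = sin x" "sin (x - of_int j * pi) = - sin x"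
proof -
  obtain k where "j = 2 * k + 1" using assms by (elim oddE)
  then have "of_int j * pi - x = (pi - x) + 2 * pi * of_int k" by (simp add: algebra_simps)
  then show *: "sin (of_int j * pi - x) = sin x"
    by (simp only: sin_add sin_int_2pin cos_int_2pin) simp
  show "sin (x - of_int j * pi) = - sin x"
    using * sin_minus[of "of_int j * pi - x"] by simp
qed

text \<open>In the two cases \<open>5 * k\<close> is \<open>2 ^ (n + 2) - 1\<close> or
  \<open>2 ^ (n + 2) + 1\<close>, so half the step angle is \<open>5 * t\<close> up to sign and an
  odd multiple of pi. The same multiple carries the ends of the sum to \<open>t\<close> and
  \<open>3 * t\<close>, and \<open>s\<close> compensates the sign.\<close>

lemma sum_two_cos_as_tan_quotient:
  assumes j: "odd j" and "\<gamma> > 0"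
    and cs: "2 ^ n = 5 * \<gamma> - 1 \<and> s = -1 \<and> A = 2 * \<gamma> \<and> B = 4 * \<gamma> - 1 \<and> k = 4 * int \<gamma> - 1 \<or>
      2 ^ n = 5 * \<gamma> + 1 \<and> s = 1 \<and> A = 2 * \<gamma> + 1 \<and> B = 4 * \<gamma> \<and> k = 4 * int \<gamma> + 1"
    and t: "t = of_int k * of_int j * (2 * pi / 2 ^ (n + 2)) / 2"
  shows "cos_comb n 1 (\<lambda>_. s) {A..B} j * sin (5 * t) = sin (5 * t) - 2 * (sin (3 * t) - sin t)"
proof -
  define x where "x = of_int j * (2 * pi / 2 ^ (n + 2))"
  have Nx: "4 * real (2 ^ n) * x = 2 * (of_int j * pi)" by (simp add: x_def)
  have t: "t = of_int k * x / 2" by (simp add: t x_def)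
  define S where "S = (\<Sum>i\<in>{A..B}. 2 * cos (real i * x))"
  have S: "sin (x / 2) * S = sin ((real B + 1 / 2) * x) - sin ((real A - 1 / 2) * x)"
    unfolding S_def using cs \<open>\<gamma> > 0\<close> by (intro sin_half_times_sum_cos) auto
  have v: "cos_comb n 1 (\<lambda>_. s) {A..B} j = 1 + 2 * of_int s * S"
    unfolding cos_comb_def S_def two_cos_def x_def by (simp add: sum_distrib_left mult_ac)
  show ?thesis using cs
  proof (elim disjE conjE)
    assume *: "2 ^ n = 5 * \<gamma> - 1" "s = -1" "A = 2 * \<gamma>" "B = 4 * \<gamma> - 1" "k = 4 * int \<gamma> - 1"
    have e: "real (2 ^ n) = 5 * real \<gamma> - 1" unfolding *(1) using \<open>\<gamma> > 0\<close> by simp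
    have jx: "of_int j * pi = 2 * (5 * real \<gamma> - 1) * x" using Nx unfolding e by (simp add: algebra_simps)
    have B: "real B = 4 * real \<gamma> - 1" using * \<open>\<gamma> > 0\<close> by simp
    have args: "(real B + 1 / 2) * x = of_int j * pi - 3 * t" "(real A - 1 / 2) * x = t"
      "x / 2 = of_int j * pi - 5 * t"
      unfolding jx B t *(3,5) by (simp_all add: field_simps)
    have "sin (5 * t) * S = sin (3 * t) - sin t"
      by (fact S[unfolded args sin_odd_pi_minus[OF j]])
    then show ?thesis unfolding v unfolding *(2) by (simp add: algebra_simps)
  next
    assume *: "2 ^ n = 5 * \<gamma> + 1" "s = 1" "A = 2 * \<gamma> + 1" "B = 4 * \<gamma>" "k = 4 * int \<gamma> + 1"
    have e: "real (2 ^ n) = 5 * real \<gamma> + 1" unfolding *(1) by simp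
    have jx: "of_int j * pi = 2 * (5 * real \<gamma> + 1) * x" using Nx unfolding e by (simp add: algebra_simps)
    have args: "(real B + 1 / 2) * x = of_int j * pi - 3 * t" "(real A - 1 / 2) * x = t"
      "x / 2 = 5 * t - of_int j * pi"
      unfolding jx t *(3-5) by (simp_all add: field_simps)
    have "- sin (5 * t) * S = sin (3 * t) - sin t"
      by (fact S[unfolded args sin_odd_pi_minus[OF j]])
    then show ?thesis unfolding v unfolding *(2) by (simp add: algebra_simps)
  qed
qed

text \<open>Since 4 is -1 modulo 5, the remainder alternates with the exponent; this is the sign
  \<open>(-1) ^ (n div 2)\<close> in \<open>u n\<close>.\<close>

lemma power_4_mod_5:
  obtains \<gamma> :: nat where "\<gamma> > 0" "(4::nat) ^ Suc h = 5 * \<gamma> - 1 \<and> odd (Suc h) \<or> (4::nat) ^ Suc h = 5 * \<gamma> + 1 \<and> even (Suc h)"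
proof -
  have "\<exists>\<gamma>>0. (4::nat) ^ Suc h = 5 * \<gamma> - 1 \<and> odd (Suc h) \<or> \<gamma> > 0 \<and> (4::nat) ^ Suc h = 5 * \<gamma> + 1 \<and> even (Suc h)"
  proof (induction h)
    case 0
    then show ?case by (intro exI[of _ 1]) simp
  next
    case (Suc h)
    then obtain \<gamma> where \<gamma>: "\<gamma> > 0" "(4::nat) ^ Suc h = 5 * \<gamma> - 1 \<and> odd (Suc h) \<or> (4::nat) ^ Suc h = 5 * \<gamma> + 1 \<and> even (Suc h)"
      by blast
    then show ?case
    proof (elim disjE conjE)
      assume "(4::nat) ^ Suc h = 5 * \<gamma> - 1" "odd (Suc h)"
      then show ?thesis using \<gamma>(1) by (intro exI[of _ "4 * \<gamma> - 1"]) auto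
    next
      assume "(4::nat) ^ Suc h = 5 * \<gamma> + 1" "even (Suc h)"
      then show ?thesis using \<gamma>(1) by (intro exI[of _ "4 * \<gamma> + 1"]) auto
    qed
  qed
  then show ?thesis using that by blast
qed

lemma sin_cos_add_odd_half_pi:
  fixes l :: int
  shows "sin (x + (of_int l * pi + pi / 2)) = cos (of_int l * pi) * cos x"
    "cos (x + (of_int l * pi + pi / 2)) = - cos (of_int l * pi) * sin x"
    "cos (of_int l * pi) \<noteq> 0"
proof -
  have 0: "sin (of_int l * pi) = 0" by (auto simp: sin_zero_iff_int2)
  then show "sin (x + (of_int l * pi + pi / 2)) = cos (of_int l * pi) * cos x"
    "cos (x + (of_int l * pi + pi / 2)) = - cos (of_int l * pi) * sin x"
    by (simp_all add: sin_add cos_add)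
  show "cos (of_int l * pi) \<noteq> 0"
    using 0 sin_cos_squared_add[of "of_int l * pi"] by auto
qed

section \<open>Conjugates of \<open>eps n\<close> and relative norms\<close>

lemma X_neq_1: "n > 0 \<Longrightarrow> X n \<noteq> 1"
  using X_eq[of "n - 1"] X_pos[of "n - 1"] by (cases "n = 1") auto

text \<open>An automorphism would carry the value 1 back to \<open>X n = 1\<close>, and the value -1
  becomes 1 after half a period. These are the denominators of the conjugates of
  \<open>eps n\<close> and of their inverses.\<close>

lemma two_cos_odd_neq:
  assumes "n > 0" "odd j" shows "two_cos n j \<noteq> 1" "two_cos n j \<noteq> -1"
proof -
  have neq: "two_cos n j \<noteq> 1" if j: "odd j" for j
  proof
    assume "two_cos n j = 1"
    then have "rat_eval [:0, 1:] (two_cos n j) = rat_eval 1 (two_cos n j)" by simp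
    moreover obtain i where i: "odd i" "two_cos n (i * j) = X n"
      using gal_map_inverse[OF assms(1) j] .
    ultimately have "gal_map n i (two_cos n j) = gal_map n i (rat_eval 1 (X n))" by simp
    then have "X n = 1"
      using i by (simp add: gal_map_two_cos[OF assms(1)] gal_map_rat_eval[OF assms(1)] mult.commute
          del: rat_eval_1) simp
    then show False using X_neq_1[OF assms(1)] by simp
  qed
  then show "two_cos n j \<noteq> 1" using assms(2) by blast
  have "two_cos n (j + 2 ^ (n + 1)) \<noteq> 1" using assms(2) by (intro neq) simp
  then show "two_cos n j \<noteq> -1" unfolding two_cos_add_half by simp
qed

lemma eps_in_BB: "eps n \<in> BB n"
  unfolding eps_def by (intro real_subfield_closed[OF real_subfield_BB] X_in_BB)

lemma gal_map_eps:
  assumes n: "n > 0" and j: "odd j"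
  shows "gal_map n j (eps n) = (two_cos n j + 1) / (two_cos n j - 1)"
proof -
  have "gal_map n j \<in> Gal (BB n) \<rat>" by (rule gal_map_in_Gal[OF n j])
  moreover have "X n - 1 \<in> BB n"
    by (intro real_subfield_closed[OF real_subfield_BB] X_in_BB)
  ultimately have "gal_map n j (eps n * (X n - 1)) = gal_map n j (eps n) * gal_map n j (X n - 1)"
    using eps_in_BB[of n] by (simp add: Gal_def)
  moreover have "eps n * (X n - 1) = X n + 1" using X_neq_1[OF n] by (simp add: eps_def)
  moreover have "gal_map n j (X n - 1) = two_cos n j - 1"
    using gal_map_rat_eval[OF n j, of "[:-1, 1:]"] by (simp add: of_rat_minus)
  moreover have "gal_map n j (X n + 1) = two_cos n j + 1"
    using gal_map_rat_eval[OF n j, of "[:1, 1:]"] by (simp add: add.commute)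
  ultimately show ?thesis using two_cos_odd_neq[OF n j] by (simp add: field_simps)
qed

text \<open>Negating \<open>y\<close> inverts \<open>(y + 1) / (y - 1)\<close>, so products of
  conjugates of \<open>eps n\<close> keep relative norm 1.\<close>

lemma gal_map_eps_mult_conj:
  assumes n: "n > 0" and j: "odd j"
  shows "gal_map n j (eps n) * conj_map n (gal_map n j (eps n)) = 1"
proof -
  have "conj_map n (gal_map n j (eps n)) = gal_map n (j * (1 + 2 ^ (n + 1))) (eps n)"
    unfolding conj_map_def mult.commute[of j]
    by (rule gal_map_comp[OF n _ j eps_in_BB]) simp
  also have "\<dots> = (two_cos n (j * (1 + 2 ^ (n + 1))) + 1) / (two_cos n (j * (1 + 2 ^ (n + 1))) - 1)"
    using j by (intro gal_map_eps[OF n]) simp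
  also have "\<dots> = (- two_cos n j + 1) / (- two_cos n j - 1)"
    unfolding two_cos_mult_conj[OF n] using j by simp
  finally show ?thesis
    unfolding gal_map_eps[OF n j] using two_cos_odd_neq[OF n j] by (simp add: field_simps)
qed

lemma conj_map_mult:
  assumes "n > 0" "x \<in> BB n" "y \<in> BB n"
  shows "conj_map n (x * y) = conj_map n x * conj_map n y"
  using conj_map_in_Gal[OF assms(1)] assms by (simp add: Gal_def)

lemma eps_product_mult_conj:
  assumes n: "n > 0" and j: "odd j"
  shows "(eps n * gal_map n j (eps n)) * conj_map n (eps n * gal_map n j (eps n)) = 1"
proof -
  have "eps n * conj_map n (eps n) = 1"
    using gal_map_eps_mult_conj[OF n, of 1] gal_map_id[OF n _ eps_in_BB, of 1] by simp
  moreover have "conj_map n (eps n * gal_map n j (eps n)) = conj_map n (eps n) * conj_map n (gal_map n j (eps n))"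
    by (intro conj_map_mult n eps_in_BB gal_map_in_BB[OF n j])
  ultimately show ?thesis using gal_map_eps_mult_conj[OF n j] by (simp add: mult_ac)
qed

lemma norm_cos_comb_even:
  assumes n: "n > 0" and \<gamma>: "\<gamma> > 0"
    and cs: "2 ^ n = 5 * \<gamma> - 1 \<and> s = -1 \<and> A = 2 * \<gamma> \<and> B = 4 * \<gamma> - 1 \<or>
      2 ^ n = 5 * \<gamma> + 1 \<and> s = 1 \<and> A = 2 * \<gamma> + 1 \<and> B = 4 * \<gamma>"
  shows "cos_comb n 1 (\<lambda>_. s) {A..B} 1 * conj_map n (cos_comb n 1 (\<lambda>_. s) {A..B} 1) = 1"
proof -
  define \<theta> where "\<theta> = 2 * pi / 2 ^ (n + 2)"
  define k where "k = (if s = -1 then 4 * int \<gamma> - 1 else 4 * int \<gamma> + 1)"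
  define t where "t j = of_int k * of_int j * \<theta> / 2" for j :: int
  define v where "v j = cos_comb n 1 (\<lambda>_. s) {A..B} j" for j
  define j' :: int where "j' = 1 + 2 ^ (n + 1)"
  have v: "v j * (cos (t j) * sin (5 * t j)) = sin (t j) * cos (5 * t j)" if "odd j" for j
    unfolding v_def using cs
    by (intro tan_quotient sum_two_cos_as_tan_quotient[OF that \<gamma>, of n s A B k])
      (auto simp: k_def t_def \<theta>_def)
  have odd: "odd (1 :: int)" "odd j'" by (simp_all add: j'_def)
  have "odd k" by (simp add: k_def)
  have N\<theta>: "2 ^ n * \<theta> = pi / 2" by (simp add: \<theta>_def)
  obtain l where l: "k = 2 * l + 1" using \<open>odd k\<close> by (elim oddE)
  have t': "t j' = t 1 + of_int k * (pi / 2)"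
    by (simp add: t_def j'_def N\<theta>[symmetric] algebra_simps)
  \<comment> \<open>With \<open>k = 2 * l + 1\<close>, five times the shift is again an odd multiple
    of pi/2, now with \<open>5 * l + 2\<close>; hence sine and cosine are exchanged at both
    angles.\<close>
  have shift: "t j' = t 1 + (of_int l * pi + pi / 2)"
    "5 * t j' = 5 * t 1 + (of_int (5 * l + 2) * pi + pi / 2)"
    unfolding t' l by (simp_all add: field_simps)
  define p q where "p = cos (of_int l * pi)" "q = cos (of_int (5 * l + 2) * pi)"
  have pq: "p \<noteq> 0" "q \<noteq> 0" unfolding p_q_def by (rule sin_cos_add_odd_half_pi(3))+
  have "cos (t j') = - p * sin (t 1)" "sin (t j') = p * cos (t 1)"
    "cos (5 * t j') = - q * sin (5 * t 1)" "sin (5 * t j') = q * cos (5 * t 1)"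
    unfolding p_q_def shift(2) by (simp_all only: shift(1) sin_cos_add_odd_half_pi)
  then have "v j' * (- p * sin (t 1) * (q * cos (5 * t 1))) = p * cos (t 1) * (- q * sin (5 * t 1))"
    using v[OF odd(2)] by simp
  then have "p * q * (v j' * (sin (t 1) * cos (5 * t 1))) = p * q * (cos (t 1) * sin (5 * t 1))"
    by (simp add: mult_ac)
  then have v': "v j' * (sin (t 1) * cos (5 * t 1)) = cos (t 1) * sin (5 * t 1)"
    using pq by simp
  \<comment> \<open>All four factors to be cancelled divide \<open>sin (2 * t 1)\<close> or
    \<open>sin (10 * t 1)\<close> up to the factor 2. The choice of \<open>k\<close> puts
    \<open>10 * t 1\<close> at distance \<open>\<theta>\<close> from \<open>2 * pi\<close>, and a
    zero of \<open>sin (2 * t 1)\<close> would be one of \<open>sin (10 * t 1)\<close>.\<close>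
  have sin_10: "sin (10 * t 1) \<noteq> 0"
  proof -
    have "0 < \<theta>" "\<theta> < pi / 2" using angle_less_half_pi[OF n] by (simp_all add: \<theta>_def)
    then have \<theta>: "sin \<theta> \<noteq> 0" using sin_gt_zero[of \<theta>] by simp
    have period: "4 * real (2 ^ n) * \<theta> = 2 * pi" using N\<theta> by (simp add: mult_ac)
    have "5 * k = 4 * int (2 ^ n) - 1 \<or> 5 * k = 4 * int (2 ^ n) + 1"
      using cs \<gamma> by (auto simp: k_def of_nat_diff simp del: of_nat_power)
    then have "5 * real_of_int k = 4 * real (2 ^ n) - 1 \<or> 5 * real_of_int k = 4 * real (2 ^ n) + 1"
      by linarith
    moreover have "10 * t 1 = 5 * real_of_int k * \<theta>" by (simp add: t_def)
    ultimately have "10 * t 1 = (4 * real (2 ^ n) - 1) * \<theta> \<or> 10 * t 1 = (4 * real (2 ^ n) + 1) * \<theta>"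
      by metis
    then have "10 * t 1 = 2 * pi - \<theta> \<or> 10 * t 1 = 2 * pi + \<theta>"
      by (simp only: distrib_right left_diff_distrib period mult_1)
    then show ?thesis using \<theta> by (auto simp: sin_diff sin_add)
  qed
  have "sin (2 * t 1) \<noteq> 0"
  proof
    assume "sin (2 * t 1) = 0"
    then obtain m where "2 * t 1 = of_int m * pi" by (auto simp: sin_zero_iff_int2)
    then have "10 * t 1 = of_int (5 * m) * pi" by simp
    then have "sin (10 * t 1) = 0" unfolding sin_zero_iff_int2 by blast
    then show False using sin_10 by simp
  qed
  then have "sin (t 1) \<noteq> 0" "cos (t 1) \<noteq> 0" by (auto simp: sin_double)
  moreover have "sin (2 * (5 * t 1)) \<noteq> 0" using sin_10 by simp
  then have "sin (5 * t 1) \<noteq> 0" "cos (5 * t 1) \<noteq> 0" unfolding sin_double by auto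
  moreover have "v 1 * (cos (t 1) * sin (5 * t 1)) * (v j' * (sin (t 1) * cos (5 * t 1)))
      = (sin (t 1) * cos (5 * t 1)) * (cos (t 1) * sin (5 * t 1))"
    unfolding v' v[OF odd(1)] ..
  ultimately have "v 1 * v j' = 1" by (simp add: field_simps)
  moreover have "conj_map n (v 1) = v j'"
    unfolding v_def conj_map_def j'_def[symmetric] by (rule gal_map_cos_comb[OF n odd(2)])
  ultimately show ?thesis by (simp add: v_def)
qed

text \<open>With \<open>2 ^ n = 5 * \<gamma> - 1\<close> the two bounds are
  \<open>2 * \<gamma> - 2 / 5\<close> and \<open>4 * \<gamma> - 4 / 5\<close> before rounding; in
  the other case the fractions are added. Either way \<open>2 ^ n / 5\<close> rounds to
  \<open>\<gamma>\<close>.\<close>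

lemma u_even_eq_cos_comb:
  assumes "even n" "n \<ge> 2"
  obtains \<gamma> s A B where "\<gamma> > 0" "2 ^ n = 5 * \<gamma> - 1 \<and> s = -1 \<and> A = 2 * \<gamma> \<and> B = 4 * \<gamma> - 1 \<or>
      2 ^ n = 5 * \<gamma> + 1 \<and> s = 1 \<and> A = 2 * \<gamma> + 1 \<and> B = 4 * \<gamma>"
    "u n = cos_comb n 1 (\<lambda>_. s) {A..B} 1" "c n = 2 * int \<gamma>"
proof -
  obtain h where h: "n = 2 * Suc h" using assms by (metis dvdE even_numeral gr0_implies_Suc mult_0_right not_numeral_le_zero zero_less_iff_neq_zero)
  obtain \<gamma> where \<gamma>: "\<gamma> > 0" "(4::nat) ^ Suc h = 5 * \<gamma> - 1 \<and> odd (Suc h) \<or> (4::nat) ^ Suc h = 5 * \<gamma> + 1 \<and> even (Suc h)"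
    by (rule power_4_mod_5)
  have pow: "(2::nat) ^ n = 4 ^ Suc h" by (simp add: h power_mult)
  define s :: int where "s = (-1) ^ Suc h"
  define A where "A = nat \<lceil>2 ^ (n + 1) / 5 :: real\<rceil>"
  define B where "B = nat \<lfloor>2 ^ (n + 2) / 5 :: real\<rfloor>"
  have r: "(2::real) ^ n = real (2 ^ n)" by simp
  have cs: "2 ^ n = 5 * \<gamma> - 1 \<and> s = -1 \<and> A = 2 * \<gamma> \<and> B = 4 * \<gamma> - 1 \<and> c n = 2 * int \<gamma> \<or>
      2 ^ n = 5 * \<gamma> + 1 \<and> s = 1 \<and> A = 2 * \<gamma> + 1 \<and> B = 4 * \<gamma> \<and> c n = 2 * int \<gamma>"
    using \<gamma>(2)
  proof (elim disjE conjE)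
    assume *: "(4::nat) ^ Suc h = 5 * \<gamma> - 1" "odd (Suc h)"
    have e: "(2::real) ^ n = 5 * real \<gamma> - 1" unfolding r pow *(1) using \<gamma>(1) by simp
    have "\<lceil>2 ^ (n + 1) / 5 :: real\<rceil> = 2 * int \<gamma>"
      unfolding power_add e by (intro ceiling_unique) (simp_all add: field_simps)
    moreover have "\<lfloor>2 ^ (n + 2) / 5 :: real\<rfloor> = 4 * int \<gamma> - 1"
      unfolding power_add e by (intro floor_unique) (simp_all add: field_simps)
    moreover have "round (2 ^ n / 5 :: real) = int \<gamma>"
      unfolding e by (intro round_unique) (simp_all add: field_simps)
    moreover have "s = -1" using *(2) unfolding s_def by simp
    moreover have "nat (2 * int \<gamma>) = 2 * \<gamma>" "nat (4 * int \<gamma> - 1) = 4 * \<gamma> - 1"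
      using \<gamma>(1) by linarith+
    ultimately show ?thesis using * pow assms by (simp add: A_def B_def c_def)
  next
    assume *: "(4::nat) ^ Suc h = 5 * \<gamma> + 1" "even (Suc h)"
    have e: "(2::real) ^ n = 5 * real \<gamma> + 1" unfolding r pow *(1) by simp
    have "\<lceil>2 ^ (n + 1) / 5 :: real\<rceil> = 2 * int \<gamma> + 1"
      unfolding power_add e by (intro ceiling_unique) (simp_all add: field_simps)
    moreover have "\<lfloor>2 ^ (n + 2) / 5 :: real\<rfloor> = 4 * int \<gamma>"
      unfolding power_add e by (intro floor_unique) (simp_all add: field_simps)
    moreover have "round (2 ^ n / 5 :: real) = int \<gamma>"
      unfolding e by (intro round_unique) (simp_all add: field_simps)
    moreover have "s = 1" using *(2) unfolding s_def by simp
    moreover have "nat (2 * int \<gamma>) = 2 * \<gamma>" "nat (4 * int \<gamma>) = 4 * \<gamma>"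
      by linarith+
    ultimately show ?thesis using * pow assms by (simp add: A_def B_def c_def nat_add_distrib)
  qed
  have "A > 0" using cs \<gamma>(1) by auto
  have "n \<noteq> 1" "n \<noteq> 3" "n \<noteq> 5" using assms by auto
  then have "u n = b n 0 + (-1) ^ (n div 2) * 2 * (\<Sum>i = A..B. b n i)"
    unfolding u_def A_def B_def by (simp only: if_False)
  also have "(\<Sum>i = A..B. b n i) = (\<Sum>i = A..B. two_cos n (int i))"
    using \<open>A > 0\<close> by (intro sum.cong refl b_eq_two_cos) auto
  also have "b n 0 + (-1) ^ (n div 2) * 2 * \<dots> = cos_comb n 1 (\<lambda>_. s) {A..B} 1"
    by (simp add: cos_comb_def b_def h s_def sum_distrib_left mult_ac)
  finally have "u n = cos_comb n 1 (\<lambda>_. s) {A..B} 1" .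
  then show ?thesis using that[of \<gamma> s A B] \<gamma>(1) cs by blast
qed

section \<open>Explicit expansions in layers 1, 3 and 5\<close>

lemma u_1: "u 1 = cos_comb 1 3 (\<lambda>_. 1) {1} 1"
proof -
  have "(X 1)\<^sup>2 = 2" using X_Suc_squared[of 0] by simp
  then have "X 1 + 1 = (3 + 2 * X 1) * (X 1 - 1)" by (simp add: algebra_simps power2_eq_square)
  then have "eps 1 = 3 + 2 * X 1" using X_neq_1[of 1] by (simp add: eps_def)
  then show ?thesis by (simp add: u_def cos_comb_def)
qed

lemma eps_product_eqI:
  assumes n: "n > 0" and j: "odd j"
    and eq: "(X n + 1) * (two_cos n j + 1) = x * ((X n - 1) * (two_cos n j - 1))"
  shows "eps n * gal_map n j (eps n) = x"
proof -
  have "X n - 1 \<noteq> 0" "two_cos n j - 1 \<noteq> 0" using X_neq_1[OF n] two_cos_odd_neq[OF n j] by simp_all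
  then show ?thesis
    unfolding gal_map_eps[OF n j] unfolding eps_def times_divide_times_eq eq by simp
qed

lemma u_3: "u 3 = eps 3 * gal_map 3 3 (eps 3)"
  by (simp add: u_def sigma_eq)

lemma u_5: "u 5 = eps 5 * gal_map 5 9 (eps 5)"
proof -
  have "gal_map 5 3 (gal_map 5 3 (eps 5)) = gal_map 5 9 (eps 5)"
    using gal_map_comp[of 5 3 3, OF _ _ _ eps_in_BB] by simp
  then show ?thesis by (simp add: u_def sigma_eq numeral_2_eq_2)
qed

lemma two_cos_half_minus: "two_cos n (2 ^ (n + 1) - i) = - two_cos n i"
  using two_cos_add_half[of n "- i"] by simp

text \<open>The numerator of the product exceeds its denominator by twice
  \<open>two_cos n 1 + two_cos n j\<close>. Writing the quotient as \<open>1 + 2 * y\<close>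
  therefore leaves an identity between cosine sums.\<close>

lemma u_expansionI:
  assumes n: "n > 0" and j: "odd j"
    and eq: "y * (two_cos n (j + 1) + two_cos n (j - 1) - two_cos n 1 - two_cos n j + 1) = two_cos n 1 + two_cos n j"
  shows "eps n * gal_map n j (eps n) = 1 + 2 * y"
proof (rule eps_product_eqI[OF n j])
  have "two_cos n j * X n = two_cos n (j + 1) + two_cos n (j - 1)"
    using two_cos_mult[of n j 1] by simp
  then show "(X n + 1) * (two_cos n j + 1) = (1 + 2 * y) * ((X n - 1) * (two_cos n j - 1))"
    using eq by (simp add: algebra_simps)
qed

lemma u_3_expansion: "u 3 = 1 + 2 * (two_cos 3 1 + two_cos 3 2 + two_cos 3 5 + two_cos 3 6)"
  unfolding u_3
proof (rule u_expansionI)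
  let ?t = "two_cos 3"
  \<comment> \<open>Products reach index \<open>6 + 4 = 10\<close>; indices are reflected at
    \<open>8 = 2 ^ 3\<close>, where the cosine vanishes.\<close>
  have r: "?t 8 = 0" "?t 9 = - ?t 7" "?t 10 = - ?t 6"
    using two_cos_half_minus[of 3 8] two_cos_half_minus[of 3 7] two_cos_half_minus[of 3 6] by simp_all
  have "(?t 1 + ?t 2 + ?t 5 + ?t 6) * (?t 4 + ?t 2 - ?t 1 - ?t 3 + 1) = ?t 1 + ?t 3"
    by (simp only: distrib_left distrib_right right_diff_distrib two_cos_mult mult_1_right)
      (simp add: r)
  then show "(?t 1 + ?t 2 + ?t 5 + ?t 6) * (?t (3 + 1) + ?t (3 - 1) - ?t 1 - ?t 3 + 1) = ?t 1 + ?t 3"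
    by simp
qed simp_all

lemma u_5_expansion: "u 5 = 1 + 2 * (two_cos 5 11 + two_cos 5 12 - two_cos 5 14 - two_cos 5 15
    + two_cos 5 17 + two_cos 5 18 + two_cos 5 19 + two_cos 5 20 - two_cos 5 22 - two_cos 5 23
    + two_cos 5 25 + two_cos 5 26)"
  unfolding u_5
proof (rule u_expansionI)
  let ?t = "two_cos 5"
  let ?y = "?t 11 + ?t 12 - ?t 14 - ?t 15 + ?t 17 + ?t 18 + ?t 19 + ?t 20 - ?t 22 - ?t 23 + ?t 25 + ?t 26"
  \<comment> \<open>The largest index is \<open>26 + 10 = 36\<close>, and the reflection takes place
    at \<open>32 = 2 ^ 5\<close>.\<close>
  have r: "?t 32 = 0" "?t 33 = - ?t 31" "?t 34 = - ?t 30" "?t 35 = - ?t 29" "?t 36 = - ?t 28"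
    using two_cos_half_minus[of 5 32] two_cos_half_minus[of 5 31] two_cos_half_minus[of 5 30]
      two_cos_half_minus[of 5 29] two_cos_half_minus[of 5 28] by simp_all
  have "?y * (?t 10 + ?t 8 - ?t 1 - ?t 9 + 1) = ?t 1 + ?t 9"
    by (simp only: distrib_left distrib_right left_diff_distrib right_diff_distrib two_cos_mult mult_1_right)
      (simp add: r)
  then show "?y * (?t (9 + 1) + ?t (9 - 1) - ?t 1 - ?t 9 + 1) = ?t 1 + ?t 9"
    by simp
qed simp_all

lemma u_3_eq_cos_comb: "u 3 = cos_comb 3 1 (\<lambda>_. 1) {1, 2, 5, 6} 1"
  by (simp add: u_3_expansion cos_comb_def)

lemma u_5_eq_cos_comb:
  "u 5 = cos_comb 5 1 (\<lambda>i. if i \<in> {14, 15, 22, 23} then -1 else 1)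
    {11, 12, 14, 15, 17, 18, 19, 20, 22, 23, 25, 26} 1"
  by (simp add: u_5_expansion cos_comb_def)

theorem theorem2p5:
  shows "u 1 = 3 * b 1 0 + 2 * b 1 1 \<and>
    u 3 = b 3 0 + 2 * (b 3 1 + b 3 2 + b 3 5 + b 3 6) \<and>
    u 5 = b 5 0 + 2 * (b 5 11 + b 5 12 - b 5 14 - b 5 15 + b 5 17 + b 5 18
                       + b 5 19 + b 5 20 - b 5 22 - b 5 23 + b 5 25 + b 5 26) \<and>
    (\<forall>n::nat. n \<in> {1, 3, 5} \<or> (even n \<and> n \<ge> 2) \<longrightarrow>
       u n \<in> RE_plus n - {1, -1} \<and>
       Tr n ((u n)\<^sup>2) = 2 ^ n * (1 + 8 * real_of_int (c n)) \<and>
       (\<exists>m \<in> {Tr n (e\<^sup>2) |e. e \<in> RE_plus n - {1, -1}}.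
          (\<forall>t \<in> {Tr n (e\<^sup>2) |e. e \<in> RE_plus n - {1, -1}}. m \<le> t) \<and>
          m \<le> 2 ^ n * (1 + 8 * real_of_int (c n))))"
proof (intro conjI allI impI)
  have b0: "b n 0 = 1" for n by (simp add: b_def)
  show "u 1 = 3 * b 1 0 + 2 * b 1 1"
    unfolding u_1 cos_comb_def by (simp add: b0 b_eq_two_cos)
  show "u 3 = b 3 0 + 2 * (b 3 1 + b 3 2 + b 3 5 + b 3 6)"
    by (simp add: u_3_expansion b0 b_eq_two_cos)
  show "u 5 = b 5 0 + 2 * (b 5 11 + b 5 12 - b 5 14 - b 5 15 + b 5 17 + b 5 18
                       + b 5 19 + b 5 20 - b 5 22 - b 5 23 + b 5 25 + b 5 26)"
    by (simp add: u_5_expansion b0 b_eq_two_cos)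
  fix n :: nat
  assume "n \<in> {1, 3, 5} \<or> (even n \<and> n \<ge> 2)"
  then consider "n = 1" | "n = 3" | "n = 5" | "even n" "n \<ge> 2" by blast
  then have "u n \<in> RE_plus n - {1, -1} \<and>
       Tr n ((u n)\<^sup>2) = 2 ^ n * (1 + 8 * real_of_int (c n)) \<and>
       (\<exists>m \<in> {Tr n (e\<^sup>2) |e. e \<in> RE_plus n - {1, -1}}.
          (\<forall>t \<in> {Tr n (e\<^sup>2) |e. e \<in> RE_plus n - {1, -1}}. m \<le> t) \<and>
          m \<le> 2 ^ n * (1 + 8 * real_of_int (c n)))"
  proof cases
    case 1
    have "u 1 = eps 1" by (simp add: u_def)
    moreover have "eps 1 * conj_map 1 (eps 1) = 1"
      using gal_map_eps_mult_conj[of 1 1] gal_map_id[of 1 1, OF _ _ eps_in_BB] by simp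
    ultimately have norm: "u 1 * conj_map 1 (u 1) = 1" by simp
    \<comment> \<open>Here the constant term is 3 with a single cosine, and
      \<open>9 + 8 = 1 + 8 * 2\<close> matches the exceptional value \<open>c 1 = 2\<close>.\<close>
    show ?thesis unfolding 1
      by (rule cos_comb_unit[OF _ _ _ u_1 norm]) (simp_all add: c_def)
  next
    case 2
    have "round (2 ^ 3 / 5 :: real) = 2" by (rule round_unique) simp_all
    then have c: "c 3 = 4" by (simp add: c_def)
    have norm: "u 3 * conj_map 3 (u 3) = 1"
      unfolding u_3 by (rule eps_product_mult_conj) simp_all
    show ?thesis unfolding 2
      by (rule cos_comb_unit[OF _ _ _ u_3_eq_cos_comb norm]) (auto simp: c)
  next
    case 3
    have "round (2 ^ 5 / 5 :: real) = 6" by (rule round_unique) simp_all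
    then have c: "c 5 = 12" by (simp add: c_def)
    have norm: "u 5 * conj_map 5 (u 5) = 1"
      unfolding u_5 by (rule eps_product_mult_conj) simp_all
    show ?thesis unfolding 3
      by (rule cos_comb_unit[OF _ _ _ u_5_eq_cos_comb norm]) (auto simp: c)
  next
    case 4
    then have n: "n > 0" by simp
    obtain \<gamma> s A B where \<gamma>: "\<gamma> > 0"
      and cs: "2 ^ n = 5 * \<gamma> - 1 \<and> s = -1 \<and> A = 2 * \<gamma> \<and> B = 4 * \<gamma> - 1 \<or>
        2 ^ n = 5 * \<gamma> + 1 \<and> s = 1 \<and> A = 2 * \<gamma> + 1 \<and> B = 4 * \<gamma>"
      and u: "u n = cos_comb n 1 (\<lambda>_. s) {A..B} 1" and c: "c n = 2 * int \<gamma>"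
      using u_even_eq_cos_comb[OF 4] .
    have norm: "u n * conj_map n (u n) = 1"
      unfolding u by (rule norm_cos_comb_even[OF n \<gamma> cs])
    \<comment> \<open>Both ranges have \<open>2 * \<gamma>\<close> terms, and
      \<open>B < 2 ^ n\<close> holds because \<open>\<gamma>\<close> is positive.\<close>
    have AB: "{A..B} \<subseteq> {0<..<2 ^ n}" "card {A..B} = 2 * \<gamma>" "s\<^sup>2 = 1"
      using cs \<gamma> by auto
    show ?thesis
      by (rule cos_comb_unit[OF n AB(1) AB(3) u norm]) (use AB(2) c \<gamma> in simp_all)
  qed
  then show "u n \<in> RE_plus n - {1, -1}"
    "Tr n ((u n)\<^sup>2) = 2 ^ n * (1 + 8 * real_of_int (c n))"
    "\<exists>m \<in> {Tr n (e\<^sup>2) |e. e \<in> RE_plus n - {1, -1}}.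
          (\<forall>t \<in> {Tr n (e\<^sup>2) |e. e \<in> RE_plus n - {1, -1}}. m \<le> t) \<and>
          m \<le> 2 ^ n * (1 + 8 * real_of_int (c n))"
    by blast+
qed

end
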